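(* The variety $\mathcal{V}_{\sigma\mathbb{RS}}$ is generated by $\mathbb{R}$: every $G\in\mathcal{V}_{\sigma\mathbb{RS}}$ is isomorphic to a subalgebra of a quotient of a power of the algebra $\mathbb{R}$ with its usual Riesz space operations ($0,+,-,\vee,\wedge$, and $\lambda\cdot-$ for $\lambda\in\mathbb{R}$) and $\bigvee^-(g,f_1,f_2,\dots)=\sup_{n\ge1}\{f_n\wedge g\}$.
   Context: $\mathcal{V}_{\sigma\mathbb{RS}}$ is the infinitary variety of algebras with the Riesz space operations plus a countably infinitary operation $\bigvee^-$ (write $\bigvee_{n\ge1}^g f_n:=\bigvee^-(g,f_1,f_2,\dots)$), satisfying the Riesz space axioms and (A1) $\bigvee_{n\ge1}^g f_n=\bigvee_{n\ge1}^g(f_n\wedge g)$; (A2) $\bigvee_{n\ge1}^g f_n=(f_1\wedge g)\vee\bigvee^-(g,f_2,f_3,\dots)$; (A3) $\bigvee_{n\ge1}^g(f_n\wedge h)\le h$ ($a\le b$ meaning $a\wedge b=a$). *)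

theory Defs
  imports Complex_Main
begin

text \<open>Algebras in the signature of sigma-Riesz spaces: carrier, 0, +, unary -,
  join, meet, scalar multiplications, and the countably infinitary operation
  ssup g f = \<Or>-(g, f 0, f 1, ...) (f 0 plays the role of f_1).\<close>

record 'a srs =
  carrier :: "'a set"
  zero :: 'a
  add :: "'a \<Rightarrow> 'a \<Rightarrow> 'a"
  neg :: "'a \<Rightarrow> 'a"
  join :: "'a \<Rightarrow> 'a \<Rightarrow> 'a"
  meet :: "'a \<Rightarrow> 'a \<Rightarrow> 'a"
  smult :: "real \<Rightarrow> 'a \<Rightarrow> 'a"
  ssup :: "'a \<Rightarrow> (nat \<Rightarrow> 'a) \<Rightarrow> 'a"

definition sle :: "'a srs \<Rightarrow> 'a \<Rightarrow> 'a \<Rightarrow> bool" where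
  "sle A a b \<longleftrightarrow> meet A a b = a"

definition closed_ops :: "'a srs \<Rightarrow> bool" where
  "closed_ops A \<longleftrightarrow>
     zero A \<in> carrier A \<and>
     (\<forall>x\<in>carrier A. \<forall>y\<in>carrier A. add A x y \<in> carrier A \<and> join A x y \<in> carrier A
        \<and> meet A x y \<in> carrier A) \<and>
     (\<forall>x\<in>carrier A. neg A x \<in> carrier A \<and> (\<forall>r. smult A r x \<in> carrier A)) \<and>
     (\<forall>g f. g \<in> carrier A \<longrightarrow> (\<forall>n. f n \<in> carrier A) \<longrightarrow> ssup A g f \<in> carrier A)"

definition riesz_axioms :: "'a srs \<Rightarrow> bool" where
  "riesz_axioms A \<longleftrightarrow>
   (\<forall>x\<in>carrier A. \<forall>y\<in>carrier A. \<forall>z\<in>carrier A.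
      add A (add A x y) z = add A x (add A y z) \<and>
      join A (join A x y) z = join A x (join A y z) \<and>
      meet A (meet A x y) z = meet A x (meet A y z)) \<and>
   (\<forall>x\<in>carrier A. \<forall>y\<in>carrier A.
      add A x y = add A y x \<and>
      join A x y = join A y x \<and> meet A x y = meet A y x \<and>
      join A x (meet A x y) = x \<and> meet A x (join A x y) = x) \<and>
   (\<forall>x\<in>carrier A. add A (zero A) x = x \<and> add A x (neg A x) = zero A \<and>
      smult A 1 x = x) \<and>
   (\<forall>x\<in>carrier A. \<forall>y\<in>carrier A. \<forall>r. smult A r (add A x y) = add A (smult A r x) (smult A r y)) \<and>
   (\<forall>x\<in>carrier A. \<forall>r s. smult A (r + s) x = add A (smult A r x) (smult A s x) \<and>
      smult A r (smult A s x) = smult A (r * s) x) \<and>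
   (\<forall>x\<in>carrier A. \<forall>y\<in>carrier A. \<forall>z\<in>carrier A.
      sle A x y \<longrightarrow> sle A (add A x z) (add A y z)) \<and>
   (\<forall>x\<in>carrier A. \<forall>y\<in>carrier A. \<forall>r::real.
      0 \<le> r \<longrightarrow> sle A x y \<longrightarrow> sle A (smult A r x) (smult A r y))"

definition sigma_rs :: "'a srs \<Rightarrow> bool" where
  "sigma_rs A \<longleftrightarrow> closed_ops A \<and> riesz_axioms A \<and>
   (\<forall>g f. g \<in> carrier A \<longrightarrow> (\<forall>n. f n \<in> carrier A) \<longrightarrow>
      ssup A g f = ssup A g (\<lambda>n. meet A (f n) g) \<and>
      ssup A g f = join A (meet A (f 0) g) (ssup A g (\<lambda>n. f (Suc n)))) \<and>
   (\<forall>g f h. g \<in> carrier A \<longrightarrow> (\<forall>n. f n \<in> carrier A) \<longrightarrow> h \<in> carrier A \<longrightarrow>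
      sle A (ssup A g (\<lambda>n. meet A (f n) h)) h)"

definition real_power :: "'i set \<Rightarrow> ('i \<Rightarrow> real) srs" where
  "real_power I = \<lparr> carrier = {x. \<forall>i. i \<notin> I \<longrightarrow> x i = 0},
     zero = (\<lambda>i. 0),
     add = (\<lambda>x y i. x i + y i),
     neg = (\<lambda>x i. - x i),
     join = (\<lambda>x y i. max (x i) (y i)),
     meet = (\<lambda>x y i. min (x i) (y i)),
     smult = (\<lambda>r x i. r * x i),
     ssup = (\<lambda>g f i. (SUP n. min (f n i) (g i))) \<rparr>"

definition congruence :: "'a srs \<Rightarrow> 'a rel \<Rightarrow> bool" where
  "congruence A \<theta> \<longleftrightarrow> equiv (carrier A) \<theta> \<and>
   (\<forall>x x' y y'. (x, x') \<in> \<theta> \<longrightarrow> (y, y') \<in> \<theta> \<longrightarrow>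
      (add A x y, add A x' y') \<in> \<theta> \<and> (join A x y, join A x' y') \<in> \<theta> \<and>
      (meet A x y, meet A x' y') \<in> \<theta>) \<and>
   (\<forall>x x' r. (x, x') \<in> \<theta> \<longrightarrow> (neg A x, neg A x') \<in> \<theta> \<and> (smult A r x, smult A r x') \<in> \<theta>) \<and>
   (\<forall>g g' f f'. (g, g') \<in> \<theta> \<longrightarrow> (\<forall>n. (f n, f' n) \<in> \<theta>) \<longrightarrow>
      (ssup A g f, ssup A g' f') \<in> \<theta>)"

definition rep :: "'a set \<Rightarrow> 'a" where "rep X = (SOME x. x \<in> X)"

definition quot :: "'a srs \<Rightarrow> 'a rel \<Rightarrow> 'a set srs" where
  "quot A \<theta> = \<lparr> carrier = carrier A // \<theta>,
     zero = \<theta> `` {zero A},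
     add = (\<lambda>X Y. \<theta> `` {add A (rep X) (rep Y)}),
     neg = (\<lambda>X. \<theta> `` {neg A (rep X)}),
     join = (\<lambda>X Y. \<theta> `` {join A (rep X) (rep Y)}),
     meet = (\<lambda>X Y. \<theta> `` {meet A (rep X) (rep Y)}),
     smult = (\<lambda>r X. \<theta> `` {smult A r (rep X)}),
     ssup = (\<lambda>G F. \<theta> `` {ssup A (rep G) (\<lambda>n. rep (F n))}) \<rparr>"

definition subalgebra :: "'a set \<Rightarrow> 'a srs \<Rightarrow> bool" where
  "subalgebra S A \<longleftrightarrow> S \<subseteq> carrier A \<and> closed_ops (A\<lparr>carrier := S\<rparr>)"

definition hom :: "('a \<Rightarrow> 'b) \<Rightarrow> 'a srs \<Rightarrow> 'b srs \<Rightarrow> bool" where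
  "hom h A B \<longleftrightarrow> (\<forall>x\<in>carrier A. h x \<in> carrier B) \<and>
   h (zero A) = zero B \<and>
   (\<forall>x\<in>carrier A. \<forall>y\<in>carrier A. h (add A x y) = add B (h x) (h y) \<and>
      h (join A x y) = join B (h x) (h y) \<and> h (meet A x y) = meet B (h x) (h y)) \<and>
   (\<forall>x\<in>carrier A. h (neg A x) = neg B (h x) \<and> (\<forall>r. h (smult A r x) = smult B r (h x))) \<and>
   (\<forall>g f. g \<in> carrier A \<longrightarrow> (\<forall>n. f n \<in> carrier A) \<longrightarrow>
      h (ssup A g f) = ssup B (h g) (\<lambda>n. h (f n)))"

definition iso_to_subalgebra :: "('a \<Rightarrow> 'b) \<Rightarrow> 'a srs \<Rightarrow> 'b set \<Rightarrow> 'b srs \<Rightarrow> bool" where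
  "iso_to_subalgebra h A S B \<longleftrightarrow> subalgebra S B \<and> hom h A B \<and> bij_betw h (carrier A) S"

end

(*
Each x in G is sent to its evaluation v |-> v x on all functions v : G -> R, so it suffices to
find a sigma-ideal of negligible sets of such v modulo which evaluation is an embedding.  By
(A1)-(A3) the infinitary operation is a countable supremum, hence G is Archimedean.  Given u > 0,
consider decreasing sequences p of positive elements below u, thought of as a shrinking basis of
neighbourhoods: comparing c with rational multiples of u on p_n cuts out a real number val c,
provided p is generic, i.e. meets countably many prescribed dense families.  The Archimedean
property makes val c finite, and each single instance of an operation, including the infinitary
one, is respected by all generic sequences.  A set of functions v is negligible if it avoids the
valuations of all generic sequences.  For a ~= b the choice u = |a - b| gives val u = 1, so val a
and val b differ; generic sequences exist by the Rasiowa-Sikorski argument.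
*)

theory Submission
  imports Defs "HOL-Library.Countable_Set"
begin

section \<open>Arithmetic of sigma-Riesz spaces\<close>

locale sigma_riesz =
  fixes G :: "'a srs"
  assumes sigma_rs: "sigma_rs G"
begin

abbreviation plusG (infixl "\<oplus>" 65) where "x \<oplus> y \<equiv> add G x y"
abbreviation negG ("\<ominus> _" [81] 80) where "\<ominus> x \<equiv> neg G x"
abbreviation zeroG ("\<zero>") where "\<zero> \<equiv> zero G"
abbreviation joinG (infixl "\<squnion>" 65) where "x \<squnion> y \<equiv> join G x y"
abbreviation meetG (infixl "\<sqinter>" 70) where "x \<sqinter> y \<equiv> meet G x y"
abbreviation smultG (infixr "\<odot>" 75) where "r \<odot> x \<equiv> smult G r x"
abbreviation leG (infix "\<sqsubseteq>" 50) where "x \<sqsubseteq> y \<equiv> sle G x y"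
abbreviation carrG ("\<G>") where "\<G> \<equiv> carrier G"

section \<open>Closure, group laws and scalar multiplication\<close>

lemma closed [simp, intro]:
  "\<zero> \<in> \<G>"
  "x \<in> \<G> \<Longrightarrow> y \<in> \<G> \<Longrightarrow> x \<oplus> y \<in> \<G>"
  "x \<in> \<G> \<Longrightarrow> y \<in> \<G> \<Longrightarrow> x \<squnion> y \<in> \<G>"
  "x \<in> \<G> \<Longrightarrow> y \<in> \<G> \<Longrightarrow> x \<sqinter> y \<in> \<G>"
  "x \<in> \<G> \<Longrightarrow> \<ominus> x \<in> \<G>"
  "x \<in> \<G> \<Longrightarrow> r \<odot> x \<in> \<G>"
  "x \<in> \<G> \<Longrightarrow> (\<And>n. f n \<in> \<G>) \<Longrightarrow> ssup G x f \<in> \<G>"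
  using sigma_rs by (auto simp: sigma_rs_def closed_ops_def)

lemma riesz: "riesz_axioms G"
  using sigma_rs by (simp add: sigma_rs_def)

lemma group_ax:
  "x \<in> \<G> \<Longrightarrow> y \<in> \<G> \<Longrightarrow> z \<in> \<G> \<Longrightarrow> x \<oplus> y \<oplus> z = x \<oplus> (y \<oplus> z)"
  "x \<in> \<G> \<Longrightarrow> y \<in> \<G> \<Longrightarrow> x \<oplus> y = y \<oplus> x"
  using riesz unfolding riesz_axioms_def by blast+

lemma add_left_comm: "x \<in> \<G> \<Longrightarrow> y \<in> \<G> \<Longrightarrow> z \<in> \<G> \<Longrightarrow> x \<oplus> (y \<oplus> z) = y \<oplus> (x \<oplus> z)"
  by (metis group_ax)

lemmas add_ac = group_ax add_left_comm

lemma zero_ax [simp]: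
  "x \<in> \<G> \<Longrightarrow> \<zero> \<oplus> x = x"
  "x \<in> \<G> \<Longrightarrow> x \<oplus> \<ominus> x = \<zero>"
  "x \<in> \<G> \<Longrightarrow> 1 \<odot> x = x"
  using riesz unfolding riesz_axioms_def by blast+

lemma group_simps [simp]:
  assumes "x \<in> \<G>"
  shows "x \<oplus> \<zero> = x" "\<ominus> x \<oplus> x = \<zero>"
  using assms by (metis closed group_ax(2) zero_ax)+

lemma add_cancel [simp]:
  assumes "x \<in> \<G>" "y \<in> \<G>"
  shows "x \<oplus> (\<ominus> x \<oplus> y) = y" "\<ominus> x \<oplus> (x \<oplus> y) = y" "y \<oplus> x \<oplus> \<ominus> x = y" "y \<oplus> \<ominus> x \<oplus> x = y"
  using assms by (simp_all flip: group_ax(1)) (simp_all add: group_ax(1))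

lemma add_right_inject:
  "x \<in> \<G> \<Longrightarrow> y \<in> \<G> \<Longrightarrow> z \<in> \<G> \<Longrightarrow> x \<oplus> z = y \<oplus> z \<longleftrightarrow> x = y"
  by (metis add_cancel(3))

lemma neg_unique: "x \<in> \<G> \<Longrightarrow> y \<in> \<G> \<Longrightarrow> x \<oplus> y = \<zero> \<Longrightarrow> \<ominus> x = y"
  by (metis add_cancel(2) closed(5) group_simps(1))

lemma neg_neg [simp]: "x \<in> \<G> \<Longrightarrow> \<ominus> (\<ominus> x) = x"
  by (simp add: neg_unique)

lemma neg_zero [simp]: "\<ominus> \<zero> = \<zero>"
  by (simp add: neg_unique)

lemma neg_add: "x \<in> \<G> \<Longrightarrow> y \<in> \<G> \<Longrightarrow> \<ominus> (x \<oplus> y) = \<ominus> x \<oplus> \<ominus> y"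
  by (rule neg_unique) (auto simp: add_ac)

lemma smult_ax:
  "x \<in> \<G> \<Longrightarrow> y \<in> \<G> \<Longrightarrow> r \<odot> (x \<oplus> y) = r \<odot> x \<oplus> r \<odot> y"
  "x \<in> \<G> \<Longrightarrow> (r + s) \<odot> x = r \<odot> x \<oplus> s \<odot> x"
  "x \<in> \<G> \<Longrightarrow> r \<odot> s \<odot> x = (r * s) \<odot> x"
  using riesz unfolding riesz_axioms_def by blast+

lemma smult_zero [simp]: "r \<odot> \<zero> = \<zero>" "x \<in> \<G> \<Longrightarrow> 0 \<odot> x = \<zero>"
proof -
  show "r \<odot> \<zero> = \<zero>"
    by (metis add_right_inject closed(1,6) smult_ax(1) zero_ax(1))
  show "x \<in> \<G> \<Longrightarrow> 0 \<odot> x = \<zero>"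
    by (metis add_right_inject closed(1,6) smult_ax(2) zero_ax(1) add_0)
qed

lemma smult_neg: "x \<in> \<G> \<Longrightarrow> r \<odot> \<ominus> x = \<ominus> (r \<odot> x)" "x \<in> \<G> \<Longrightarrow> (- r) \<odot> x = \<ominus> (r \<odot> x)"
  by (rule neg_unique[symmetric]; simp flip: smult_ax)+

section \<open>The lattice order and its compatibility with the vector operations\<close>

lemma lattice_ax:
  "x \<in> \<G> \<Longrightarrow> y \<in> \<G> \<Longrightarrow> z \<in> \<G> \<Longrightarrow> x \<squnion> y \<squnion> z = x \<squnion> (y \<squnion> z)"
  "x \<in> \<G> \<Longrightarrow> y \<in> \<G> \<Longrightarrow> z \<in> \<G> \<Longrightarrow> x \<sqinter> y \<sqinter> z = x \<sqinter> (y \<sqinter> z)"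
  "x \<in> \<G> \<Longrightarrow> y \<in> \<G> \<Longrightarrow> x \<squnion> y = y \<squnion> x"
  "x \<in> \<G> \<Longrightarrow> y \<in> \<G> \<Longrightarrow> x \<sqinter> y = y \<sqinter> x"
  "x \<in> \<G> \<Longrightarrow> y \<in> \<G> \<Longrightarrow> x \<squnion> x \<sqinter> y = x"
  "x \<in> \<G> \<Longrightarrow> y \<in> \<G> \<Longrightarrow> x \<sqinter> (x \<squnion> y) = x"
  using riesz unfolding riesz_axioms_def by blast+

lemma le_refl [simp]: "x \<in> \<G> \<Longrightarrow> x \<sqsubseteq> x"
  unfolding sle_def by (metis lattice_ax(5,6) closed(4))

lemma le_trans [trans]: "x \<sqsubseteq> y \<Longrightarrow> y \<sqsubseteq> z \<Longrightarrow> x \<in> \<G> \<Longrightarrow> y \<in> \<G> \<Longrightarrow> z \<in> \<G> \<Longrightarrow> x \<sqsubseteq> z"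
  unfolding sle_def by (metis lattice_ax(2))

lemma le_antisym: "x \<sqsubseteq> y \<Longrightarrow> y \<sqsubseteq> x \<Longrightarrow> x \<in> \<G> \<Longrightarrow> y \<in> \<G> \<Longrightarrow> x = y"
  unfolding sle_def by (metis lattice_ax(4))

lemma le_iff_join: "x \<in> \<G> \<Longrightarrow> y \<in> \<G> \<Longrightarrow> x \<sqsubseteq> y \<longleftrightarrow> x \<squnion> y = y"
  unfolding sle_def by (metis lattice_ax(3-6))

lemma meet_le [simp]: "x \<in> \<G> \<Longrightarrow> y \<in> \<G> \<Longrightarrow> x \<sqinter> y \<sqsubseteq> x" "x \<in> \<G> \<Longrightarrow> y \<in> \<G> \<Longrightarrow> x \<sqinter> y \<sqsubseteq> y"
  by (metis le_iff_join lattice_ax(3-5) closed(4))+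

lemma le_meet: "z \<sqsubseteq> x \<Longrightarrow> z \<sqsubseteq> y \<Longrightarrow> x \<in> \<G> \<Longrightarrow> y \<in> \<G> \<Longrightarrow> z \<in> \<G> \<Longrightarrow> z \<sqsubseteq> x \<sqinter> y"
  unfolding sle_def by (metis lattice_ax(2))

lemma le_join [simp]: "x \<in> \<G> \<Longrightarrow> y \<in> \<G> \<Longrightarrow> x \<sqsubseteq> x \<squnion> y" "x \<in> \<G> \<Longrightarrow> y \<in> \<G> \<Longrightarrow> y \<sqsubseteq> x \<squnion> y"
  unfolding sle_def by (metis lattice_ax(3,6))+

lemma join_le: "x \<sqsubseteq> z \<Longrightarrow> y \<sqsubseteq> z \<Longrightarrow> x \<in> \<G> \<Longrightarrow> y \<in> \<G> \<Longrightarrow> z \<in> \<G> \<Longrightarrow> x \<squnion> y \<sqsubseteq> z"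
  by (metis le_iff_join lattice_ax(1) closed(3))

lemma add_right_mono: "x \<sqsubseteq> y \<Longrightarrow> x \<in> \<G> \<Longrightarrow> y \<in> \<G> \<Longrightarrow> z \<in> \<G> \<Longrightarrow> x \<oplus> z \<sqsubseteq> y \<oplus> z"
  using riesz unfolding riesz_axioms_def by blast

lemma smult_mono: "0 \<le> r \<Longrightarrow> x \<sqsubseteq> y \<Longrightarrow> x \<in> \<G> \<Longrightarrow> y \<in> \<G> \<Longrightarrow> r \<odot> x \<sqsubseteq> r \<odot> y"
  using riesz unfolding riesz_axioms_def by blast

lemma add_mono:
  assumes "x \<sqsubseteq> y" "z \<sqsubseteq> w" "x \<in> \<G>" "y \<in> \<G>" "z \<in> \<G>" "w \<in> \<G>"
  shows "x \<oplus> z \<sqsubseteq> y \<oplus> w"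
  using assms add_right_mono[of x y z] add_right_mono[of z w y]
  by (metis le_trans closed(2) group_ax(2))

lemma le_add_neg_iff: "x \<in> \<G> \<Longrightarrow> y \<in> \<G> \<Longrightarrow> z \<in> \<G> \<Longrightarrow> z \<sqsubseteq> x \<oplus> \<ominus> y \<longleftrightarrow> z \<oplus> y \<sqsubseteq> x"
  by (metis add_cancel(3,4) add_right_mono closed(2,5))

lemma add_neg_le_iff: "x \<in> \<G> \<Longrightarrow> y \<in> \<G> \<Longrightarrow> z \<in> \<G> \<Longrightarrow> x \<oplus> \<ominus> y \<sqsubseteq> z \<longleftrightarrow> x \<sqsubseteq> z \<oplus> y"
  by (metis add_cancel(3,4) add_right_mono closed(2,5))

lemma neg_mono: "x \<sqsubseteq> y \<Longrightarrow> x \<in> \<G> \<Longrightarrow> y \<in> \<G> \<Longrightarrow> \<ominus> y \<sqsubseteq> \<ominus> x"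
  using add_right_mono[of x y "\<ominus> x \<oplus> \<ominus> y"] by (simp add: add_left_comm[of y])

lemma neg_le_iff: "x \<in> \<G> \<Longrightarrow> y \<in> \<G> \<Longrightarrow> \<ominus> x \<sqsubseteq> y \<longleftrightarrow> \<ominus> y \<sqsubseteq> x"
  by (metis neg_mono neg_neg closed(5))

lemma le_add_nonneg: "\<zero> \<sqsubseteq> y \<Longrightarrow> x \<in> \<G> \<Longrightarrow> y \<in> \<G> \<Longrightarrow> x \<sqsubseteq> x \<oplus> y"
  using add_mono[of x x \<zero> y] by simp

lemma add_nonneg: "\<zero> \<sqsubseteq> x \<Longrightarrow> \<zero> \<sqsubseteq> y \<Longrightarrow> x \<in> \<G> \<Longrightarrow> y \<in> \<G> \<Longrightarrow> \<zero> \<sqsubseteq> x \<oplus> y"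
  using add_mono[of \<zero> x \<zero> y] by simp

lemma smult_nonneg: "0 \<le> r \<Longrightarrow> \<zero> \<sqsubseteq> x \<Longrightarrow> x \<in> \<G> \<Longrightarrow> \<zero> \<sqsubseteq> r \<odot> x"
  using smult_mono[of r \<zero> x] by simp

lemma smult_left_mono:
  assumes "r \<le> s" "\<zero> \<sqsubseteq> x" "x \<in> \<G>"
  shows "r \<odot> x \<sqsubseteq> s \<odot> x"
proof -
  have "r \<odot> x \<sqsubseteq> r \<odot> x \<oplus> (s - r) \<odot> x"
    using assms by (intro le_add_nonneg smult_nonneg) auto
  then show ?thesis
    using assms by (simp flip: smult_ax(2))
qed

section \<open>The infinitary operation as a countable supremum; the Archimedean property\<close>

lemma ssup_ge:
  assumes "g \<in> \<G>" "\<And>n. f n \<in> \<G>"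
  shows "f n \<sqinter> g \<sqsubseteq> ssup G g f"
  using assms
\<comment> \<open>(A2) peels off the first term and leaves the shifted sequence, so \<open>f\<close>
  has to vary in the induction.\<close>
proof (induction n arbitrary: f)
  case (0 f)
  have "ssup G g f = f 0 \<sqinter> g \<squnion> ssup G g (\<lambda>n. f (Suc n))"
    using sigma_rs 0 unfolding sigma_rs_def by blast
  then show ?case using 0 by simp
next
  case (Suc n f)
  have eq: "ssup G g f = f 0 \<sqinter> g \<squnion> ssup G g (\<lambda>n. f (Suc n))"
    using sigma_rs Suc.prems unfolding sigma_rs_def by blast
  have "f (Suc n) \<sqinter> g \<sqsubseteq> ssup G g (\<lambda>n. f (Suc n))"
    using Suc.IH[of "\<lambda>n. f (Suc n)"] Suc.prems by simp
  also have "\<dots> \<sqsubseteq> ssup G g f"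
    unfolding eq using Suc.prems by simp
  finally show ?case using Suc.prems by simp
qed

text \<open>(A1) replaces \<open>f n\<close> by \<open>f n \<sqinter> g\<close>, and meeting this
  with \<open>h\<close> changes nothing by the last hypothesis; (A3) then bounds the supremum by
  \<open>h\<close>.\<close>

lemma ssup_least:
  assumes "g \<in> \<G>" "\<And>n. f n \<in> \<G>" "h \<in> \<G>" "\<And>n. f n \<sqinter> g \<sqsubseteq> h"
  shows "ssup G g f \<sqsubseteq> h"
proof -
  have "ssup G g f = ssup G g (\<lambda>n. f n \<sqinter> g)"
    using sigma_rs assms(1,2) unfolding sigma_rs_def by blast
  moreover have "(\<lambda>n. (f n \<sqinter> g) \<sqinter> h) = (\<lambda>n. f n \<sqinter> g)"
    using assms(4) by (simp add: sle_def)
  moreover have "\<forall>g f h. g \<in> \<G> \<longrightarrow> (\<forall>n. f n \<in> \<G>) \<longrightarrow> h \<in> \<G> \<longrightarrow> ssup G g (\<lambda>n. f n \<sqinter> h) \<sqsubseteq> h"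
    using sigma_rs unfolding sigma_rs_def by (elim conjE)
  from this[rule_format, of g "\<lambda>n. f n \<sqinter> g" h] have "ssup G g (\<lambda>n. f n \<sqinter> g \<sqinter> h) \<sqsubseteq> h"
    using assms(1-3) by blast
  ultimately show ?thesis by metis
qed

text \<open>The multiples of \<open>p\<close> have a supremum \<open>s\<close> because
  \<open>c\<close> bounds them. Shifting the multiples by one shows that
  \<open>s \<oplus> \<ominus> p\<close> bounds them as well, so \<open>p\<close> is at most
  zero.\<close>

lemma archimedean:
  assumes "p \<in> \<G>" "c \<in> \<G>" "\<zero> \<sqsubseteq> p" "\<And>n. real n \<odot> p \<sqsubseteq> c"
  shows "p = \<zero>"
proof -
  define s where "s = ssup G c (\<lambda>n. real n \<odot> p)"
  have s: "s \<in> \<G>" using assms by (simp add: s_def)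
  have ge: "real n \<odot> p \<sqsubseteq> s" for n
    using ssup_ge[of c "\<lambda>n. real n \<odot> p" n] assms by (simp add: s_def sle_def)
  have "real n \<odot> p \<sqsubseteq> s \<oplus> \<ominus> p" for n
    using ge[of "Suc n"] assms s smult_ax(2)[of p "real n" 1]
    by (simp add: le_add_neg_iff add.commute)
  then have "s \<sqsubseteq> s \<oplus> \<ominus> p"
    using assms s unfolding s_def by (intro ssup_least) (simp_all add: sle_def)
  then have "s \<oplus> p \<sqsubseteq> s" using s assms by (simp add: le_add_neg_iff)
  from add_right_mono[OF this, of "\<ominus> s"] have "p \<sqsubseteq> \<zero>"
    using s assms by (simp add: add_ac)
  then show ?thesis using assms by (intro le_antisym) auto
qed

section \<open>Disjointness and the forcing relation\<close>

definition npart :: "'a \<Rightarrow> 'a" where "npart c = \<ominus> c \<squnion> \<zero>"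

text \<open>With \<open>p\<close> read as the indicator of the open set where it does not vanish:
  \<open>c\<close> is nonnegative on that set.\<close>

definition forces :: "'a \<Rightarrow> 'a \<Rightarrow> bool" where
  "forces p c \<longleftrightarrow> p \<sqinter> npart c = \<zero>"

lemma npart [simp]:
  assumes "c \<in> \<G>"
  shows "npart c \<in> \<G>" "\<zero> \<sqsubseteq> npart c" "\<ominus> c \<sqsubseteq> npart c"
  using assms by (simp_all add: npart_def)

lemma npart_le: "\<ominus> c \<sqsubseteq> y \<Longrightarrow> \<zero> \<sqsubseteq> y \<Longrightarrow> c \<in> \<G> \<Longrightarrow> y \<in> \<G> \<Longrightarrow> npart c \<sqsubseteq> y"
  by (simp add: npart_def join_le)

lemma meet_nonneg: "\<zero> \<sqsubseteq> x \<Longrightarrow> \<zero> \<sqsubseteq> y \<Longrightarrow> x \<in> \<G> \<Longrightarrow> y \<in> \<G> \<Longrightarrow> \<zero> \<sqsubseteq> x \<sqinter> y"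
  by (simp add: le_meet)

lemma disjointI:
  assumes "p \<in> \<G>" "\<zero> \<sqsubseteq> p" "y \<in> \<G>" "\<zero> \<sqsubseteq> y" "p \<sqinter> y \<sqsubseteq> \<zero>"
  shows "p \<sqinter> y = \<zero>"
  using assms by (intro le_antisym meet_nonneg) auto

lemma disjoint_mono:
  assumes "p \<sqinter> y = \<zero>" "p' \<sqsubseteq> p" "y' \<sqsubseteq> y" "\<zero> \<sqsubseteq> p'" "\<zero> \<sqsubseteq> y'"
    "p \<in> \<G>" "y \<in> \<G>" "p' \<in> \<G>" "y' \<in> \<G>"
  shows "p' \<sqinter> y' = \<zero>"
proof (rule disjointI)
  have "p' \<sqinter> y' \<sqsubseteq> p \<sqinter> y"
    using assms by (intro le_meet) (auto intro: le_trans[OF meet_le(1)] le_trans[OF meet_le(2)])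
  then show "p' \<sqinter> y' \<sqsubseteq> \<zero>" using assms by simp
qed (use assms in auto)

text \<open>\<open>w \<oplus> \<ominus> b\<close> lies below \<open>a\<close> by the first
  hypothesis and below \<open>w\<close> since \<open>b\<close> is nonnegative, hence below their
  meet, which is zero.\<close>

lemma disjoint_le_add:
  assumes "w \<sqsubseteq> a \<oplus> b" "w \<sqinter> a = \<zero>" "\<zero> \<sqsubseteq> b" "w \<in> \<G>" "a \<in> \<G>" "b \<in> \<G>"
  shows "w \<sqsubseteq> b"
proof -
  have "w \<oplus> \<ominus> b \<sqsubseteq> w \<sqinter> a"
    using assms by (intro le_meet) (auto simp: add_neg_le_iff le_add_nonneg)
  then show ?thesis using assms by (simp add: add_neg_le_iff)
qed

text \<open>The part of \<open>p\<close> below \<open>y \<oplus> z\<close> is disjoint from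
  \<open>y\<close>, so it already lies below \<open>z\<close>, from which \<open>p\<close> is
  disjoint too.\<close>

lemma disjoint_add:
  assumes "p \<sqinter> y = \<zero>" "p \<sqinter> z = \<zero>" "\<zero> \<sqsubseteq> p" "\<zero> \<sqsubseteq> y" "\<zero> \<sqsubseteq> z" "p \<in> \<G>" "y \<in> \<G>" "z \<in> \<G>"
  shows "p \<sqinter> (y \<oplus> z) = \<zero>"
proof (rule disjointI)
  let ?w = "p \<sqinter> (y \<oplus> z)"
  have "?w \<sqinter> y = \<zero>"
    using assms by (intro disjoint_mono[OF assms(1), of ?w y]) (auto intro: meet_nonneg add_nonneg)
  then have "?w \<sqsubseteq> z"
    using assms by (intro disjoint_le_add[of ?w y z]) auto
  then have "?w \<sqsubseteq> p \<sqinter> z"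
    using assms by (intro le_meet) auto
  then show "?w \<sqsubseteq> \<zero>" using assms by simp
qed (use assms in \<open>auto intro: add_nonneg\<close>)

lemma disjoint_smult:
  assumes "p \<sqinter> y = \<zero>" "0 \<le> r" "\<zero> \<sqsubseteq> p" "\<zero> \<sqsubseteq> y" "p \<in> \<G>" "y \<in> \<G>"
  shows "p \<sqinter> r \<odot> y = \<zero>"
proof (cases "r \<le> 1")
  case True
  then have "r \<odot> y \<sqsubseteq> y" using smult_left_mono[of r 1 y] assms by simp
  then show ?thesis
    using assms by (intro disjoint_mono[OF assms(1)]) (auto intro: smult_nonneg)
next
  case False
  \<comment> \<open>Multiplying the meet by \<open>inverse r\<close> brings it below
    \<open>y\<close> and, because \<open>r > 1\<close>, keeps it below \<open>p\<close>.\<close>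
  let ?w = "p \<sqinter> r \<odot> y"
  have w: "\<zero> \<sqsubseteq> ?w" using assms by (intro meet_nonneg smult_nonneg) auto
  have "inverse r \<odot> ?w \<sqsubseteq> inverse r \<odot> r \<odot> y"
    using assms False by (intro smult_mono) auto
  then have 1: "inverse r \<odot> ?w \<sqsubseteq> y" using assms False by (simp add: smult_ax)
  have "inverse r \<odot> ?w \<sqsubseteq> 1 \<odot> ?w"
    using assms w False by (intro smult_left_mono) (auto simp: field_simps)
  then have "inverse r \<odot> ?w \<sqsubseteq> p"
    using assms by (auto intro: le_trans)
  with 1 have "inverse r \<odot> ?w \<sqsubseteq> p \<sqinter> y"
    using assms by (intro le_meet) auto
  then have "r \<odot> inverse r \<odot> ?w \<sqsubseteq> r \<odot> \<zero>"
    using assms by (intro smult_mono) auto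
  then have "?w \<sqsubseteq> \<zero>"
    using assms False by (subst (asm) smult_ax(3)) auto
  then show ?thesis
    using assms by (intro disjointI smult_nonneg) auto
qed

text \<open>\<open>npart (\<ominus> c)\<close> is the positive part of \<open>c\<close>. If
  \<open>w\<close> is its meet with \<open>npart c\<close>, then
  \<open>npart c \<oplus> \<ominus> w\<close> still dominates \<open>\<ominus> c\<close> and zero;
  as \<open>npart c\<close> is the least such element, \<open>w\<close> vanishes.\<close>

lemma npart_disjoint:
  assumes "c \<in> \<G>"
  shows "npart (\<ominus> c) \<sqinter> npart c = \<zero>"
proof (rule disjointI)
  let ?w = "npart (\<ominus> c) \<sqinter> npart c"
  have "?w \<sqsubseteq> npart (\<ominus> c)" "?w \<sqsubseteq> npart c" using assms by auto
  have "npart (\<ominus> c) \<sqsubseteq> c \<oplus> npart c"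
  proof (rule npart_le)
    show "\<ominus> (\<ominus> c) \<sqsubseteq> c \<oplus> npart c" using assms by (simp add: le_add_nonneg)
    have "c \<oplus> \<ominus> c \<sqsubseteq> c \<oplus> npart c" using assms by (intro add_mono) auto
    then show "\<zero> \<sqsubseteq> c \<oplus> npart c" using assms by simp
  qed (use assms in auto)
  from le_trans[OF \<open>?w \<sqsubseteq> npart (\<ominus> c)\<close> this] have "?w \<sqsubseteq> c \<oplus> npart c"
    using assms by simp
  then have "\<ominus> c \<oplus> ?w \<sqsubseteq> \<ominus> c \<oplus> (c \<oplus> npart c)"
    using assms by (intro add_mono) auto
  then have "\<ominus> c \<sqsubseteq> npart c \<oplus> \<ominus> ?w"
    using assms by (simp add: le_add_neg_iff)
  moreover have "\<zero> \<sqsubseteq> npart c \<oplus> \<ominus> ?w"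
    using assms by (simp add: le_add_neg_iff)
  ultimately have "npart c \<sqsubseteq> npart c \<oplus> \<ominus> ?w"
    using assms by (intro npart_le) auto
  then have "?w \<oplus> npart c \<sqsubseteq> \<zero> \<oplus> npart c"
    using assms by (simp add: le_add_neg_iff group_ax(2))
  from add_right_mono[OF this, of "\<ominus> npart c"] show "?w \<sqsubseteq> \<zero>"
    using assms by simp
qed (use assms in auto)

definition pos :: "'a \<Rightarrow> bool" where
  "pos p \<longleftrightarrow> p \<in> \<G> \<and> \<zero> \<sqsubseteq> p \<and> p \<noteq> \<zero>"

lemma posD [dest]: assumes "pos p" shows "p \<in> \<G>" "\<zero> \<sqsubseteq> p"
  using assms by (auto simp: pos_def)

lemma forces_mono:
  assumes "forces p c" "c \<sqsubseteq> d" "p' \<sqsubseteq> p" "pos p" "pos p'" "c \<in> \<G>" "d \<in> \<G>"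
  shows "forces p' d"
  unfolding forces_def
proof (rule disjoint_mono)
  show "p \<sqinter> npart c = \<zero>" using assms by (simp add: forces_def)
  have "\<ominus> d \<sqsubseteq> npart c" using assms neg_mono[of c d] by (auto intro: le_trans)
  then show "npart d \<sqsubseteq> npart c" using assms by (intro npart_le) auto
qed (use assms in auto)

text \<open>Common core of closure under sums and meets: in both cases the negative part of the
  result is bounded by the sum of the negative parts, and disjointness from \<open>p\<close> passes
  to sums.\<close>

lemma forces_le_add:
  assumes "forces p c" "forces p d" "npart e \<sqsubseteq> npart c \<oplus> npart d"
    "pos p" "c \<in> \<G>" "d \<in> \<G>" "e \<in> \<G>"
  shows "forces p e"
  unfolding forces_def
proof (rule disjoint_mono)
  show "p \<sqinter> (npart c \<oplus> npart d) = \<zero>"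
    using assms unfolding forces_def by (intro disjoint_add) auto
qed (use assms in auto)

lemma forces_add:
  assumes "forces p c" "forces p d" "pos p" "c \<in> \<G>" "d \<in> \<G>"
  shows "forces p (c \<oplus> d)"
proof (rule forces_le_add[OF assms(1,2)])
  show "npart (c \<oplus> d) \<sqsubseteq> npart c \<oplus> npart d"
    using assms by (intro npart_le) (auto simp: neg_add intro: add_mono add_nonneg)
qed (use assms in auto)

lemma forces_meet:
  assumes "forces p c" "forces p d" "pos p" "c \<in> \<G>" "d \<in> \<G>"
  shows "forces p (c \<sqinter> d)"
proof (rule forces_le_add[OF assms(1,2)])
  let ?s = "npart c \<oplus> npart d"
  have "\<ominus> c \<sqsubseteq> ?s"
    using assms by (intro le_trans[OF npart(3) le_add_nonneg]) auto
  moreover have "\<ominus> d \<sqsubseteq> npart d \<oplus> npart c"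
    using assms by (intro le_trans[OF npart(3) le_add_nonneg]) auto
  ultimately have "\<ominus> ?s \<sqsubseteq> c \<sqinter> d"
    using assms by (intro le_meet) (auto simp: neg_le_iff group_ax(2))
  then show "npart (c \<sqinter> d) \<sqsubseteq> ?s"
    using assms by (intro npart_le) (auto simp: neg_le_iff intro: add_nonneg)
qed (use assms in auto)

lemma forces_smult:
  assumes "forces p c" "0 \<le> r" "pos p" "c \<in> \<G>"
  shows "forces p (r \<odot> c)"
  unfolding forces_def
proof (rule disjoint_mono)
  show "p \<sqinter> r \<odot> npart c = \<zero>"
    using assms unfolding forces_def by (intro disjoint_smult) auto
  show "npart (r \<odot> c) \<sqsubseteq> r \<odot> npart c"
    using assms by (intro npart_le) (auto intro: smult_nonneg smult_mono simp flip: smult_neg)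
qed (use assms in auto)

lemma forces_nonneg:
  assumes "\<zero> \<sqsubseteq> c" "pos p" "c \<in> \<G>"
  shows "forces p c"
proof -
  have "\<ominus> c \<sqsubseteq> \<zero>" using assms neg_mono[of \<zero> c] by simp
  then have "npart c = \<zero>"
    using assms by (intro le_antisym npart_le) auto
  then show ?thesis using assms unfolding forces_def by (intro disjointI) auto
qed

text \<open>Consistency of forcing: rescaling would make \<open>p\<close> force
  \<open>\<ominus> u\<close>, so \<open>p\<close> would be disjoint from
  \<open>npart (\<ominus> u)\<close>, which lies above \<open>u\<close> and hence above
  \<open>p\<close>.\<close>

lemma not_forces_neg:
  assumes "pos p" "p \<sqsubseteq> u" "u \<in> \<G>" "r < 0"
  shows "\<not> forces p (r \<odot> u)"
proof
  assume "forces p (r \<odot> u)"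
  then have "forces p (inverse (- r) \<odot> r \<odot> u)"
    by (rule forces_smult) (use assms in auto)
  moreover have "inverse (- r) \<odot> r \<odot> u = (- 1) \<odot> u"
    using assms by (subst smult_ax(3)) auto
  ultimately have "forces p (\<ominus> u)"
    using assms smult_neg(2)[of u 1] by simp
  then have "p \<sqinter> npart (\<ominus> u) = \<zero>" by (simp add: forces_def)
  moreover have "p \<sqsubseteq> p \<sqinter> npart (\<ominus> u)"
  proof (rule le_meet)
    have "u \<sqsubseteq> npart (\<ominus> u)" using npart(3)[of "\<ominus> u"] assms by simp
    then show "p \<sqsubseteq> npart (\<ominus> u)" using assms by (auto intro: le_trans)
  qed (use assms in auto)
  ultimately show False
    using assms le_antisym[of p \<zero>] by (auto simp: pos_def)
qed

text \<open>The witness is the part of \<open>p\<close> on which \<open>c\<close> is positive. It is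
  nonzero because \<open>p\<close> does not force \<open>\<ominus> c\<close>, and it forces
  \<open>c\<close> because positive and negative parts are disjoint.\<close>

lemma forces_decide:
  assumes "pos p" "c \<in> \<G>" "\<not> forces p (\<ominus> c)"
  shows "pos (p \<sqinter> npart (\<ominus> c))" "forces (p \<sqinter> npart (\<ominus> c)) c"
proof -
  show "pos (p \<sqinter> npart (\<ominus> c))"
    using assms by (auto simp: pos_def forces_def intro: meet_nonneg)
  show "forces (p \<sqinter> npart (\<ominus> c)) c"
    unfolding forces_def
    by (rule disjoint_mono[OF npart_disjoint]) (use assms in \<open>auto intro: meet_nonneg\<close>)
qed

text \<open>Finiteness of values. If no multiple of \<open>p\<close> exceeded the positive part of
  \<open>c\<close> on any part of \<open>p\<close>, all multiples would lie below that positive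
  part, against the Archimedean property.\<close>

lemma ex_forces_bound:
  assumes p: "pos p" "p \<sqsubseteq> u" and u: "u \<in> \<G>" and c: "c \<in> \<G>"
  shows "\<exists>p' r. pos p' \<and> p' \<sqsubseteq> p \<and> forces p' (r \<odot> u \<oplus> \<ominus> c)"
proof -
  let ?c = "npart (\<ominus> c)"
  have cc: "c \<sqsubseteq> ?c" using npart(3)[of "\<ominus> c"] c by simp
  \<comment> \<open>Multiples of \<open>p\<close> rather than of \<open>u\<close> are compared with
    the positive part of \<open>c\<close>: an excess can then occur only where \<open>p\<close> does
    not vanish, so a bound on \<open>p\<close> is a bound everywhere.\<close>
  have "\<exists>n. \<not> forces p (\<ominus> (real n \<odot> p \<oplus> \<ominus> ?c))"
  proof (rule ccontr)
    assume *: "\<nexists>n. \<not> forces p (\<ominus> (real n \<odot> p \<oplus> \<ominus> ?c))"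
    have "real n \<odot> p \<sqsubseteq> ?c" for n
    proof -
      let ?x = "real n \<odot> p \<oplus> \<ominus> ?c"
      \<comment> \<open>The excess of \<open>real n \<odot> p\<close> over \<open>?c\<close>. It is
        disjoint from \<open>real n \<odot> p\<close> and also below it, so it vanishes.\<close>
      let ?v = "npart (\<ominus> ?x)"
      have x: "?x \<in> \<G>" using p c by auto
      have "p \<sqinter> ?v = \<zero>" using * by (simp add: forces_def)
      then have "?v \<sqinter> p = \<zero>" using p x by (auto simp: lattice_ax(4))
      then have "?v \<sqinter> real n \<odot> p = \<zero>" using p x by (intro disjoint_smult) auto
      moreover have "?x \<sqsubseteq> real n \<odot> p"
        using p c by (auto simp: add_neg_le_iff le_add_nonneg)
      then have "?v \<sqsubseteq> real n \<odot> p"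
        using p x by (intro npart_le) (auto intro: smult_nonneg)
      ultimately have "?v = \<zero>" by (simp add: sle_def)
      then have "?x \<sqsubseteq> \<zero>" using npart(3)[of "\<ominus> ?x"] x by simp
      then show ?thesis using p c by (auto simp: add_neg_le_iff)
    qed
    then have "p = \<zero>" using p c by (intro archimedean[of p ?c]) auto
    then show False using p by (simp add: pos_def)
  qed
  then obtain n where n: "\<not> forces p (\<ominus> (real n \<odot> p \<oplus> \<ominus> ?c))" by blast
  let ?p = "p \<sqinter> npart (\<ominus> (real n \<odot> p \<oplus> \<ominus> ?c))"
  have 1: "pos ?p" "forces ?p (real n \<odot> p \<oplus> \<ominus> ?c)"
    using forces_decide[OF p(1) _ n] p c by auto
  have "real n \<odot> p \<oplus> \<ominus> ?c \<sqsubseteq> real n \<odot> u \<oplus> \<ominus> c"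
    using p c u cc by (intro add_mono smult_mono neg_mono) auto
  then have "forces ?p (real n \<odot> u \<oplus> \<ominus> c)"
    using forces_mono[OF 1(2) _ _ 1(1) 1(1)] p c u 1 by auto
  moreover have "?p \<sqsubseteq> p" using p c by auto
  ultimately show ?thesis using 1 by blast
qed

text \<open>\<open>?w\<close> is the excess of the supremum over \<open>e\<close>, cut down to
  \<open>p\<close>. Since no \<open>f n \<sqinter> g\<close> exceeds \<open>e\<close> on
  \<open>p\<close>, subtracting \<open>?w\<close> from the supremum still leaves an upper bound, and
  leastness gives \<open>?w = \<zero>\<close>.\<close>

lemma forces_ssup:
  assumes p: "pos p" and g: "g \<in> \<G>" and f: "\<And>n. f n \<in> \<G>" and e: "e \<in> \<G>"
    and F: "\<And>n. forces p (e \<oplus> \<ominus> (f n \<sqinter> g))"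
  shows "forces p (e \<oplus> \<ominus> ssup G g f)"
proof -
  define s where "s = ssup G g f"
  have s: "s \<in> \<G>" using g f by (simp add: s_def)
  let ?w = "p \<sqinter> npart (e \<oplus> \<ominus> s)"
  have w: "?w \<in> \<G>" "\<zero> \<sqsubseteq> ?w" using p e s by (auto intro: meet_nonneg)
  have "f n \<sqinter> g \<sqsubseteq> s \<oplus> \<ominus> ?w" for n
  proof -
    define h where "h = f n \<sqinter> g"
    have h: "h \<in> \<G>" using g f by (simp add: h_def)
    have hs: "h \<sqsubseteq> s" unfolding h_def s_def by (rule ssup_ge[OF g f])
    have eh: "e \<oplus> \<ominus> h \<in> \<G>" "e \<oplus> \<ominus> s \<in> \<G>" using e h s by auto
    have sh: "s \<oplus> \<ominus> h \<in> \<G>" "\<zero> \<sqsubseteq> s \<oplus> \<ominus> h" using h s hs by (auto simp: le_add_neg_iff)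
    \<comment> \<open>The shortfall of \<open>e\<close> below \<open>s\<close> is at most its
      shortfall below \<open>h\<close> plus the distance from \<open>h\<close> to \<open>s\<close>;
      the first summand is disjoint from \<open>p\<close>.\<close>
    have "npart (e \<oplus> \<ominus> s) \<sqsubseteq> npart (e \<oplus> \<ominus> h) \<oplus> (s \<oplus> \<ominus> h)"
    proof (rule npart_le)
      have "\<ominus> (e \<oplus> \<ominus> h) \<oplus> (s \<oplus> \<ominus> h) \<sqsubseteq> npart (e \<oplus> \<ominus> h) \<oplus> (s \<oplus> \<ominus> h)"
        by (rule add_mono) (use eh sh in auto)
      also have "\<ominus> (e \<oplus> \<ominus> h) \<oplus> (s \<oplus> \<ominus> h) = \<ominus> (e \<oplus> \<ominus> s)"
        using e h s by (simp add: neg_add group_ax(1) add_left_comm[of h s])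
      finally show "\<ominus> (e \<oplus> \<ominus> s) \<sqsubseteq> npart (e \<oplus> \<ominus> h) \<oplus> (s \<oplus> \<ominus> h)" .
    qed (use eh sh in \<open>auto intro: add_nonneg\<close>)
    moreover have "?w \<sqsubseteq> npart (e \<oplus> \<ominus> s)" using p eh by auto
    ultimately have "?w \<sqsubseteq> npart (e \<oplus> \<ominus> h) \<oplus> (s \<oplus> \<ominus> h)"
      using w eh sh by (meson le_trans closed(2) npart(1))
    moreover have "?w \<sqinter> npart (e \<oplus> \<ominus> h) = \<zero>"
      by (rule disjoint_mono[OF F[of n, unfolded forces_def]])
        (use p w eh in \<open>auto simp: h_def\<close>)
    ultimately have "?w \<sqsubseteq> s \<oplus> \<ominus> h"
      using w eh sh by (intro disjoint_le_add[of ?w "npart (e \<oplus> \<ominus> h)" "s \<oplus> \<ominus> h"]) auto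
    then show ?thesis
      unfolding h_def[symmetric] using w h s by (simp add: le_add_neg_iff group_ax(2))
  qed
  then have "s \<sqsubseteq> s \<oplus> \<ominus> ?w"
    unfolding s_def using g f w by (intro ssup_least) (auto simp: s_def)
  then have "?w \<oplus> s \<sqsubseteq> \<zero> \<oplus> s" using w s by (simp add: le_add_neg_iff group_ax(2))
  from add_right_mono[OF this, of "\<ominus> s"] have "?w \<sqsubseteq> \<zero>" using w s by simp
  then show ?thesis using w le_antisym[of ?w \<zero>] by (simp add: forces_def s_def)
qed

subsection \<open>Values along decreasing sequences\<close>

text \<open>\<open>u\<close> is not only a bound: it is the unit in which values along the chain are
  measured.\<close>

definition chain :: "'a \<Rightarrow> (nat \<Rightarrow> 'a) \<Rightarrow> bool" where
  "chain u p \<longleftrightarrow> u \<in> \<G> \<and> p 0 \<sqsubseteq> u \<and> (\<forall>n. pos (p n) \<and> p (Suc n) \<sqsubseteq> p n)"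

text \<open>On a chain one index suffices, as all later members are smaller and force the same
  elements.\<close>

definition ev_forces :: "(nat \<Rightarrow> 'a) \<Rightarrow> 'a \<Rightarrow> bool" where
  "ev_forces p c \<longleftrightarrow> (\<exists>n. forces (p n) c)"

lemma chain_antimono:
  assumes "chain u p" "m \<le> n"
  shows "p n \<sqsubseteq> p m"
  using assms(2)
proof (induction rule: dec_induct)
  case base
  then show ?case using assms unfolding chain_def by (meson le_refl posD(1))
next
  case (step k)
  then show ?case using assms unfolding chain_def by (meson le_trans posD(1))
qed

lemma chainD:
  assumes "chain u p"
  shows "u \<in> \<G>" "pos (p n)" "p n \<in> \<G>" "p n \<sqsubseteq> u" "\<zero> \<sqsubseteq> u"
proof -
  show 1: "u \<in> \<G>" "pos (p n)" "p n \<in> \<G>" using assms by (auto simp: chain_def)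
  show 2: "p n \<sqsubseteq> u"
    using chain_antimono[OF assms, of 0 n] assms unfolding chain_def by (meson le_trans posD(1) le0)
  show "\<zero> \<sqsubseteq> u" using 1 2 by (meson le_trans posD closed(1))
qed

lemma ev_forces_mono:
  assumes "chain u p" "ev_forces p c" "c \<sqsubseteq> d" "c \<in> \<G>" "d \<in> \<G>"
  shows "ev_forces p d"
  using assms forces_mono chainD[OF assms(1)] unfolding ev_forces_def by (meson le_refl)

lemma ev_forces_both:
  assumes "chain u p" "ev_forces p c" "ev_forces p d" "c \<in> \<G>" "d \<in> \<G>"
  obtains n where "forces (p n) c" "forces (p n) d"
proof -
  obtain k l where kl: "forces (p k) c" "forces (p l) d"
    using assms by (auto simp: ev_forces_def)
  have "forces (p (max k l)) c" "forces (p (max k l)) d"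
    by (rule forces_mono[OF kl(1)] forces_mono[OF kl(2)];
        use assms in \<open>auto intro: chain_antimono dest: chainD\<close>)+
  then show ?thesis using that by blast
qed

lemma ev_forces_add:
  assumes "chain u p" "ev_forces p c" "ev_forces p d" "c \<in> \<G>" "d \<in> \<G>"
  shows "ev_forces p (c \<oplus> d)"
  using ev_forces_both[OF assms] forces_add chainD(2)[OF assms(1)] assms(4,5)
  unfolding ev_forces_def by metis

lemma ev_forces_meet:
  assumes "chain u p" "ev_forces p c" "ev_forces p d" "c \<in> \<G>" "d \<in> \<G>"
  shows "ev_forces p (c \<sqinter> d)"
  using ev_forces_both[OF assms] forces_meet chainD(2)[OF assms(1)] assms(4,5)
  unfolding ev_forces_def by metis

text \<open>The lower Dedekind cut of the value of \<open>c\<close>; the upper cut is the lower cut of \<open>\<ominus> c\<close>.\<close>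

definition lower :: "'a \<Rightarrow> (nat \<Rightarrow> 'a) \<Rightarrow> 'a \<Rightarrow> real \<Rightarrow> bool" where
  "lower u p c t \<longleftrightarrow> (\<forall>q<t. ev_forces p (c \<oplus> (- q) \<odot> u))"

definition has_val :: "'a \<Rightarrow> (nat \<Rightarrow> 'a) \<Rightarrow> 'a \<Rightarrow> real \<Rightarrow> bool" where
  "has_val u p c t \<longleftrightarrow> lower u p c t \<and> lower u p (\<ominus> c) (- t)"

lemma lowerI:
  assumes "chain u p" "c \<in> \<G>" "ev_forces p (c \<oplus> (- q) \<odot> u)"
  shows "lower u p c q"
  unfolding lower_def
proof safe
  fix r assume "r < q"
  note u = chainD(1,5)[OF assms(1)]
  have "(- q) \<odot> u \<sqsubseteq> (- r) \<odot> u" using u \<open>r < q\<close> by (intro smult_left_mono) auto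
  then have "c \<oplus> (- q) \<odot> u \<sqsubseteq> c \<oplus> (- r) \<odot> u" using assms(2) u by (intro add_mono) auto
  then show "ev_forces p (c \<oplus> (- r) \<odot> u)"
    by (rule ev_forces_mono[OF assms(1,3)]) (use assms(2) u in auto)
qed

lemma lower_mono:
  assumes "chain u p" "lower u p c t" "c \<sqsubseteq> d" "c \<in> \<G>" "d \<in> \<G>"
  shows "lower u p d t"
  unfolding lower_def
proof safe
  fix q assume "q < t"
  then have *: "ev_forces p (c \<oplus> (- q) \<odot> u)" using assms by (simp add: lower_def)
  show "ev_forces p (d \<oplus> (- q) \<odot> u)"
    by (rule ev_forces_mono[OF assms(1) *])
      (use assms chainD(1)[OF assms(1)] in \<open>auto intro: add_right_mono\<close>)
qed

text \<open>With \<open>t < q < r < s\<close>, the chain would force both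
  \<open>c \<oplus> (- r) \<odot> u\<close> and \<open>\<ominus> c \<oplus> q \<odot> u\<close>,
  hence their sum, a negative multiple of \<open>u\<close>.\<close>

lemma lower_le:
  assumes "chain u p" "lower u p c s" "lower u p (\<ominus> c) (- t)" "c \<in> \<G>"
  shows "s \<le> t"
proof (rule ccontr)
  assume "\<not> s \<le> t"
  then obtain q r where qr: "t < q" "q < r" "r < s" by (meson dense not_le)
  note u = chainD(1)[OF assms(1)]
  have "ev_forces p (c \<oplus> (- r) \<odot> u)" "ev_forces p (\<ominus> c \<oplus> q \<odot> u)"
    using assms(2,3)[unfolded lower_def, rule_format, of r]
      assms(3)[unfolded lower_def, rule_format, of "- q"] qr by auto
  then have "ev_forces p ((c \<oplus> (- r) \<odot> u) \<oplus> (\<ominus> c \<oplus> q \<odot> u))"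
    by (rule ev_forces_add[OF assms(1)]) (use assms u in auto)
  also have "(c \<oplus> (- r) \<odot> u) \<oplus> (\<ominus> c \<oplus> q \<odot> u) = (q - r) \<odot> u"
    using assms u smult_ax(2)[of u "- r" q]
    by (simp add: group_ax(1) add_left_comm[of "(- r) \<odot> u" "\<ominus> c"])
  finally show False
    using not_forces_neg[OF chainD(2,4,1)[OF assms(1)], of "q - r"] qr
    unfolding ev_forces_def by auto
qed

lemma lower_add:
  assumes "chain u p" "lower u p c s" "lower u p d t" "c \<in> \<G>" "d \<in> \<G>"
  shows "lower u p (c \<oplus> d) (s + t)"
  unfolding lower_def
proof safe
  fix q assume "q < s + t"
  \<comment> \<open>Half of the slack goes to each summand:
    \<open>q = (s - e) + (t - e)\<close>.\<close>
  define e where "e = (s + t - q) / 2"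
  have e: "e > 0" "- q = - (s - e) + - (t - e)" using \<open>q < s + t\<close> by (auto simp: e_def field_simps)
  note u = chainD(1)[OF assms(1)]
  have "ev_forces p (c \<oplus> (- (s - e)) \<odot> u)" "ev_forces p (d \<oplus> (- (t - e)) \<odot> u)"
    using assms(2)[unfolded lower_def, rule_format, of "s - e"]
      assms(3)[unfolded lower_def, rule_format, of "t - e"] e(1) by auto
  then have "ev_forces p ((c \<oplus> (- (s - e)) \<odot> u) \<oplus> (d \<oplus> (- (t - e)) \<odot> u))"
    by (rule ev_forces_add[OF assms(1)]) (use assms u in auto)
  also have "(c \<oplus> (- (s - e)) \<odot> u) \<oplus> (d \<oplus> (- (t - e)) \<odot> u) = c \<oplus> d \<oplus> (- q) \<odot> u"
    unfolding e(2) using assms u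
    by (simp only: smult_ax(2)) (simp add: group_ax(1) add_left_comm[of "(e - s) \<odot> u" d])
  finally show "ev_forces p (c \<oplus> d \<oplus> (- q) \<odot> u)" .
qed

lemma meet_add_le:
  assumes "c \<in> \<G>" "d \<in> \<G>" "e \<in> \<G>"
  shows "(c \<oplus> e) \<sqinter> (d \<oplus> e) \<sqsubseteq> c \<sqinter> d \<oplus> e"
proof -
  have "(c \<oplus> e) \<sqinter> (d \<oplus> e) \<oplus> \<ominus> e \<sqsubseteq> c \<sqinter> d"
    using assms by (intro le_meet) (auto simp: add_neg_le_iff)
  then show ?thesis using assms by (simp add: add_neg_le_iff)
qed

lemma lower_meet:
  assumes "chain u p" "lower u p c s" "lower u p d t" "c \<in> \<G>" "d \<in> \<G>"
  shows "lower u p (c \<sqinter> d) (min s t)"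
  unfolding lower_def
proof safe
  fix q assume "q < min s t"
  note u = chainD(1)[OF assms(1)]
  have "ev_forces p (c \<oplus> (- q) \<odot> u)" "ev_forces p (d \<oplus> (- q) \<odot> u)"
    using assms \<open>q < min s t\<close> by (auto simp: lower_def)
  then have *: "ev_forces p ((c \<oplus> (- q) \<odot> u) \<sqinter> (d \<oplus> (- q) \<odot> u))"
    by (rule ev_forces_meet[OF assms(1)]) (use assms u in auto)
  show "ev_forces p (c \<sqinter> d \<oplus> (- q) \<odot> u)"
    by (rule ev_forces_mono[OF assms(1) *]) (use assms u meet_add_le in auto)
qed

lemma lower_zero:
  assumes "chain u p"
  shows "lower u p \<zero> 0"
  unfolding lower_def ev_forces_def
  using assms chainD[OF assms] by (auto intro!: exI forces_nonneg smult_nonneg)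

lemma lower_smult:
  assumes "chain u p" "lower u p c t" "0 < r" "c \<in> \<G>"
  shows "lower u p (r \<odot> c) (r * t)"
  unfolding lower_def
proof safe
  fix q assume "q < r * t"
  then have "q / r < t" using assms by (simp add: field_simps)
  then obtain n where "forces (p n) (c \<oplus> (- (q / r)) \<odot> u)"
    using assms by (auto simp: lower_def ev_forces_def)
  then have "forces (p n) (r \<odot> (c \<oplus> (- (q / r)) \<odot> u))"
    using assms chainD[OF assms(1)] by (intro forces_smult) auto
  also have "r \<odot> (c \<oplus> (- (q / r)) \<odot> u) = r \<odot> c \<oplus> (- q) \<odot> u"
    using assms chainD[OF assms(1)] by (simp add: smult_ax)
  finally show "ev_forces p (r \<odot> c \<oplus> (- q) \<odot> u)" by (auto simp: ev_forces_def)
qed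

section \<open>Values of the Riesz space operations\<close>

lemma has_val_unique:
  "chain u p \<Longrightarrow> has_val u p c s \<Longrightarrow> has_val u p c t \<Longrightarrow> c \<in> \<G> \<Longrightarrow> s = t"
  unfolding has_val_def by (meson lower_le order_antisym)

lemma has_val_mono:
  assumes "chain u p" "has_val u p c s" "has_val u p d t" "c \<sqsubseteq> d" "c \<in> \<G>" "d \<in> \<G>"
  shows "s \<le> t"
  using assms unfolding has_val_def by (meson lower_mono lower_le)

lemma has_val_neg: "has_val u p c t \<Longrightarrow> c \<in> \<G> \<Longrightarrow> has_val u p (\<ominus> c) (- t)"
  by (simp add: has_val_def)

lemma has_val_zero: "chain u p \<Longrightarrow> has_val u p \<zero> 0"
  by (simp add: has_val_def lower_zero)

text \<open>This normalization is what separates points in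
  \<open>generically_val_eqD\<close>.\<close>

lemma has_val_unit:
  assumes "chain u p"
  shows "has_val u p u 1"
  unfolding has_val_def
proof
  have "ev_forces p (u \<oplus> (- 1) \<odot> u)" "ev_forces p (\<ominus> u \<oplus> (- (- 1)) \<odot> u)"
    using chainD[OF assms] by (auto simp: smult_neg ev_forces_def intro!: forces_nonneg)
  then show "lower u p u 1" "lower u p (\<ominus> u) (- 1)"
    using assms chainD(1)[OF assms] by (auto intro: lowerI)
qed

lemma has_val_add:
  assumes "chain u p" "has_val u p c s" "has_val u p d t" "c \<in> \<G>" "d \<in> \<G>"
  shows "has_val u p (c \<oplus> d) (s + t)"
  using assms lower_add[OF assms(1), of "\<ominus> c" "- s" "\<ominus> d" "- t"] lower_add[OF assms(1)]
  unfolding has_val_def by (simp add: neg_add)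

lemma has_val_meet:
  assumes "chain u p" "has_val u p c s" "has_val u p d t" "c \<in> \<G>" "d \<in> \<G>"
  shows "has_val u p (c \<sqinter> d) (min s t)"
proof -
  have "\<ominus> c \<sqsubseteq> \<ominus> (c \<sqinter> d)" "\<ominus> d \<sqsubseteq> \<ominus> (c \<sqinter> d)"
    using assms by (auto intro: neg_mono)
  then have "lower u p (\<ominus> (c \<sqinter> d)) (- s)" "lower u p (\<ominus> (c \<sqinter> d)) (- t)"
    using assms unfolding has_val_def by (meson lower_mono closed)+
  then have "lower u p (\<ominus> (c \<sqinter> d)) (- min s t)" by (simp add: min_def)
  then show ?thesis
    using assms lower_meet[OF assms(1)] by (simp add: has_val_def)
qed

text \<open>The lower cut follows by monotonicity from each argument; the upper cut reduces to
  \<open>lower_meet\<close> for the negatives through a De Morgan inequality.\<close>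

lemma has_val_join:
  assumes "chain u p" "has_val u p c s" "has_val u p d t" "c \<in> \<G>" "d \<in> \<G>"
  shows "has_val u p (c \<squnion> d) (max s t)"
  unfolding has_val_def
proof
  have "lower u p (c \<squnion> d) s" "lower u p (c \<squnion> d) t"
    using assms unfolding has_val_def by (meson lower_mono closed le_join)+
  then show "lower u p (c \<squnion> d) (max s t)" by (simp add: max_def)
  have *: "lower u p (\<ominus> c \<sqinter> \<ominus> d) (min (- s) (- t))"
    using assms by (intro lower_meet) (auto simp: has_val_def)
  have "c \<sqsubseteq> \<ominus> (\<ominus> c \<sqinter> \<ominus> d)" "d \<sqsubseteq> \<ominus> (\<ominus> c \<sqinter> \<ominus> d)"
    using assms neg_mono[of "\<ominus> c \<sqinter> \<ominus> d" "\<ominus> c"] neg_mono[of "\<ominus> c \<sqinter> \<ominus> d" "\<ominus> d"] by auto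
  then have "c \<squnion> d \<sqsubseteq> \<ominus> (\<ominus> c \<sqinter> \<ominus> d)"
    using assms by (intro join_le) auto
  then have "\<ominus> c \<sqinter> \<ominus> d \<sqsubseteq> \<ominus> (c \<squnion> d)"
    using assms neg_mono[of "c \<squnion> d" "\<ominus> (\<ominus> c \<sqinter> \<ominus> d)"] by auto
  from lower_mono[OF assms(1) * this] show "lower u p (\<ominus> (c \<squnion> d)) (- max s t)"
    using assms by (simp add: minus_max_eq_min)
qed

lemma has_val_smult:
  assumes "chain u p" "has_val u p c t" "c \<in> \<G>"
  shows "has_val u p (r \<odot> c) (r * t)"
proof -
  \<comment> \<open>Positive scalars stretch both cuts; negative ones are reached by negation, which
    swaps the cuts.\<close>
  have pos: "has_val u p (r \<odot> c) (r * t)" if "r > 0" for r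
    using that assms lower_smult[OF assms(1), of c t r] lower_smult[OF assms(1), of "\<ominus> c" "- t" r]
    by (simp add: has_val_def smult_neg)
  show ?thesis
  proof (cases r "0 :: real" rule: linorder_cases)
    case less
    then show ?thesis
      using has_val_neg[OF pos[of "- r"]] assms by (simp add: smult_neg)
  next
    case equal
    then show ?thesis using assms by (simp add: has_val_zero)
  qed (rule pos)
qed

subsection \<open>Genericity\<close>

text \<open>A family assigns a set to each unit \<open>u\<close>, so that one countable collection
  serves the chains below all units.\<close>

definition dense_family :: "('a \<Rightarrow> 'a set) \<Rightarrow> bool" where
  "dense_family D \<longleftrightarrow> (\<forall>u p. u \<in> \<G> \<longrightarrow> pos p \<longrightarrow> p \<sqsubseteq> u \<longrightarrow> (\<exists>p'. pos p' \<and> p' \<sqsubseteq> p \<and> p' \<in> D u))"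

text \<open>\<open>P\<close> holds for all sufficiently generic chains, in the sense of Baire category.\<close>

definition generically :: "('a \<Rightarrow> (nat \<Rightarrow> 'a) \<Rightarrow> bool) \<Rightarrow> bool" where
  "generically P \<longleftrightarrow> (\<exists>\<D>. countable \<D> \<and> (\<forall>D\<in>\<D>. dense_family D) \<and>
     (\<forall>u p. chain u p \<longrightarrow> (\<forall>D\<in>\<D>. \<exists>n. p n \<in> D u) \<longrightarrow> P u p))"

lemma generically_always: "(\<And>u p. chain u p \<Longrightarrow> P u p) \<Longrightarrow> generically P"
  unfolding generically_def by (rule exI[of _ "{}"]) auto

lemma generically_dense: "dense_family D \<Longrightarrow> generically (\<lambda>u p. \<exists>n. p n \<in> D u)"
  unfolding generically_def by (rule exI[of _ "{D}"]) auto

text \<open>A countable union of countable collections is countable. This is what makes the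
  negligible sets a sigma-ideal and lets the infinitary operation pass to the quotient.\<close>

lemma generically_all:
  assumes "countable I" "\<And>i. i \<in> I \<Longrightarrow> generically (P i)"
  shows "generically (\<lambda>u p. \<forall>i\<in>I. P i u p)"
proof -
  have "\<forall>i\<in>I. \<exists>\<D>. countable \<D> \<and> (\<forall>D\<in>\<D>. dense_family D) \<and>
     (\<forall>u p. chain u p \<longrightarrow> (\<forall>D\<in>\<D>. \<exists>n. p n \<in> D u) \<longrightarrow> P i u p)"
    using assms(2) unfolding generically_def by blast
  then obtain \<D> where \<D>: "\<And>i. i \<in> I \<Longrightarrow> countable (\<D> i)" "\<And>i D. i \<in> I \<Longrightarrow> D \<in> \<D> i \<Longrightarrow> dense_family D"
    "\<And>i u p. i \<in> I \<Longrightarrow> chain u p \<Longrightarrow> (\<And>D. D \<in> \<D> i \<Longrightarrow> \<exists>n. p n \<in> D u) \<Longrightarrow> P i u p"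
    unfolding bchoice_iff by metis
  show ?thesis
    unfolding generically_def
  proof (intro exI[of _ "\<Union>i\<in>I. \<D> i"] conjI allI impI ballI)
    show "countable (\<Union>i\<in>I. \<D> i)" using \<D>(1) assms(1) by (rule countable_UN[rotated])
    show "dense_family D" if "D \<in> (\<Union>i\<in>I. \<D> i)" for D
      using that \<D>(2) by blast
    show "P i u p" if "chain u p" "\<forall>D\<in>\<Union>i\<in>I. \<D> i. \<exists>n. p n \<in> D u" "i \<in> I" for i u p
      using that by (intro \<D>(3)) auto
  qed
qed

lemma generically_mono:
  assumes "generically P" "\<And>u p. chain u p \<Longrightarrow> P u p \<Longrightarrow> Q u p"
  shows "generically Q"
  using assms unfolding generically_def by meson

lemma generically_conj:
  assumes "generically P" "generically Q"
  shows "generically (\<lambda>u p. P u p \<and> Q u p)"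
proof -
  \<comment> \<open>Binary conjunction is the countable one indexed by the two truth values.\<close>
  have "generically (\<lambda>u p. \<forall>b\<in>UNIV. (if b then P else Q) u p)"
    using assms by (intro generically_all) auto
  then show ?thesis by (rule generically_mono) (auto split: if_splits dest: spec)
qed

text \<open>The Rasiowa--Sikorski lemma.\<close>

lemma generically_ex:
  assumes "generically P" "pos u"
  shows "\<exists>p. chain u p \<and> P u p"
proof -
  obtain \<D> where \<D>: "countable \<D>" "\<And>D. D \<in> \<D> \<Longrightarrow> dense_family D"
    "\<And>u p. chain u p \<Longrightarrow> (\<And>D. D \<in> \<D> \<Longrightarrow> \<exists>n. p n \<in> D u) \<Longrightarrow> P u p"
    using assms(1) unfolding generically_def by metis
  \<comment> \<open>The trivial family is added so that there is something to enumerate even when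
    \<open>\<D>\<close> is empty.\<close>
  let ?E = "insert (\<lambda>_. UNIV) \<D>"
  have dense: "dense_family (from_nat_into ?E n)" for n
  proof -
    have "from_nat_into ?E n \<in> ?E" by (rule from_nat_into) simp
    moreover have "dense_family (\<lambda>_. UNIV)"
      unfolding dense_family_def by (meson UNIV_I le_refl posD(1))
    ultimately show ?thesis using \<D>(2) by auto
  qed
  have "\<exists>p. p 0 = u \<and> (\<forall>n. (pos (p n) \<and> p n \<sqsubseteq> u) \<and> (p (Suc n) \<sqsubseteq> p n \<and> p (Suc n) \<in> from_nat_into ?E n u))"
  \<comment> \<open>The clause for \<open>n = 0\<close> pins the start of the sequence to
    \<open>u\<close>; the family with number \<open>n\<close> is met at stage
    \<open>Suc n\<close>.\<close>
  proof (rule dependent_nat_choice[where P = "\<lambda>n x. (n = 0 \<longrightarrow> x = u) \<and> pos x \<and> x \<sqsubseteq> u"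
        and Q = "\<lambda>n x y. y \<sqsubseteq> x \<and> y \<in> from_nat_into ?E n u", THEN ex_forward])
    show "\<exists>x. (0 = (0::nat) \<longrightarrow> x = u) \<and> pos x \<and> x \<sqsubseteq> u" using assms(2) by auto
    show "\<exists>y. ((Suc n = 0 \<longrightarrow> y = u) \<and> pos y \<and> y \<sqsubseteq> u) \<and> y \<sqsubseteq> x \<and> y \<in> from_nat_into ?E n u"
      if "(n = 0 \<longrightarrow> x = u) \<and> pos x \<and> x \<sqsubseteq> u" for x n
      using that dense[of n] assms(2) unfolding dense_family_def by (metis le_trans nat.distinct(1) posD(1))
  qed auto
  then obtain p where p: "p 0 = u" "\<And>n. pos (p n)" "\<And>n. p (Suc n) \<sqsubseteq> p n"
      "\<And>n. p (Suc n) \<in> from_nat_into ?E n u" by blast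
  have "chain u p" using p assms(2) by (auto simp: chain_def)
  moreover have "\<exists>n. p n \<in> D u" if "D \<in> \<D>" for D
    using p(4)[of "to_nat_on ?E D"] that \<D>(1) by auto
  ultimately show ?thesis using \<D>(3) by blast
qed

section \<open>Dense families that determine values\<close>

lemma dense_decide:
  assumes "c \<in> \<G>"
  shows "dense_family (\<lambda>u. {p. forces p (c \<oplus> (- q) \<odot> u) \<or> forces p (\<ominus> c \<oplus> q \<odot> u)})"
  unfolding dense_family_def
proof (intro allI impI)
  fix u p assume u: "u \<in> \<G>" and p: "pos p"
  let ?x = "c \<oplus> (- q) \<odot> u"
  have "\<ominus> ?x = \<ominus> c \<oplus> q \<odot> u" using u assms by (simp add: neg_add smult_neg)
  moreover have "?x \<in> \<G>" "p \<sqinter> npart (\<ominus> ?x) \<sqsubseteq> p" using u p assms by auto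
  \<comment> \<open>Either \<open>p\<close> already forces \<open>\<ominus> ?x\<close>, or it
    shrinks to its part on which \<open>?x\<close> is positive.\<close>
  ultimately show "\<exists>p'. pos p' \<and> p' \<sqsubseteq> p \<and> p' \<in> {p. forces p ?x \<or> forces p (\<ominus> c \<oplus> q \<odot> u)}"
    using forces_decide[OF p, of ?x] p by (metis (mono_tags) le_refl mem_Collect_eq posD(1))
qed

lemma dense_bounded:
  assumes "c \<in> \<G>"
  shows "dense_family (\<lambda>u. {p. \<exists>r. forces p (c \<oplus> (- r) \<odot> u)})"
  unfolding dense_family_def
proof (intro allI impI)
  fix u p assume u: "u \<in> \<G>" and p: "pos p" "p \<sqsubseteq> u"
  \<comment> \<open>An upper bound for \<open>\<ominus> c\<close> is a lower bound for
    \<open>c\<close>, whence the change of sign of \<open>r\<close>.\<close>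
  obtain p' r where "pos p'" "p' \<sqsubseteq> p" "forces p' (r \<odot> u \<oplus> \<ominus> (\<ominus> c))"
    using ex_forces_bound[OF p u, of "\<ominus> c"] assms by auto
  moreover have "r \<odot> u \<oplus> \<ominus> (\<ominus> c) = c \<oplus> (- (- r)) \<odot> u" using u assms by (simp add: group_ax(2))
  ultimately show "\<exists>p'. pos p' \<and> p' \<sqsubseteq> p \<and> p' \<in> {p. \<exists>r. forces p (c \<oplus> (- r) \<odot> u)}"
    by (metis mem_Collect_eq)
qed

text \<open>Deciding only rational thresholds keeps the number of families countable. The two
  boundedness families make the lower cut nonempty and bounded above, so its supremum is a real
  value.\<close>

lemma generically_has_val:
  assumes c: "c \<in> \<G>"
  shows "generically (\<lambda>u p. \<exists>t. has_val u p c t)"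
proof -
  have "generically (\<lambda>u p. (\<forall>q\<in>\<rat>. \<exists>n. p n \<in> {p. forces p (c \<oplus> (- q) \<odot> u) \<or> forces p (\<ominus> c \<oplus> q \<odot> u)}) \<and>
     (\<exists>n. p n \<in> {p. \<exists>r. forces p (c \<oplus> (- r) \<odot> u)}) \<and> (\<exists>n. p n \<in> {p. \<exists>r. forces p (\<ominus> c \<oplus> (- r) \<odot> u)}))"
    using c by (intro generically_conj generically_all generically_dense dense_decide dense_bounded countable_rat closed)
  then show ?thesis
  proof (rule generically_mono)
    fix u p
    assume ch: "chain u p" and
     *: "(\<forall>q\<in>\<rat>. \<exists>n. p n \<in> {p. forces p (c \<oplus> (- q) \<odot> u) \<or> forces p (\<ominus> c \<oplus> q \<odot> u)}) \<and>
     (\<exists>n. p n \<in> {p. \<exists>r. forces p (c \<oplus> (- r) \<odot> u)}) \<and> (\<exists>n. p n \<in> {p. \<exists>r. forces p (\<ominus> c \<oplus> (- r) \<odot> u)})"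
    have decide: "lower u p c q \<or> lower u p (\<ominus> c) (- q)" if "q \<in> \<rat>" for q
    proof -
      have "ev_forces p (c \<oplus> (- q) \<odot> u) \<or> ev_forces p (\<ominus> c \<oplus> (- (- q)) \<odot> u)"
        using * that by (auto simp: ev_forces_def)
      then show ?thesis using lowerI[OF ch] c by blast
    qed
    obtain a b where "ev_forces p (c \<oplus> (- a) \<odot> u)" "ev_forces p (\<ominus> c \<oplus> (- b) \<odot> u)"
      using * unfolding ev_forces_def by blast
    then have a: "lower u p c a" and b: "lower u p (\<ominus> c) b"
      using lowerI[OF ch] c by blast+
    define t where "t = Sup {q. lower u p c q}"
    have bdd: "bdd_above {q. lower u p c q}"
      using lower_le[OF ch, of c _ "- b"] b c by (intro bdd_aboveI[of _ "- b"]) auto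
    have "lower u p c t"
      unfolding lower_def
    proof safe
      fix q assume "q < t"
      then obtain r where "lower u p c r" "q < r"
        using less_cSup_iff[OF _ bdd, of q] a by (auto simp: t_def)
      then show "ev_forces p (c \<oplus> (- q) \<odot> u)" by (simp add: lower_def)
    qed
    moreover have "lower u p (\<ominus> c) (- t)"
      unfolding lower_def
    proof safe
      \<comment> \<open>A rational strictly above \<open>t\<close> is outside the lower cut, so the
        decision at it falls to the upper side.\<close>
      fix q assume "q < - t"
      then obtain r where r: "r \<in> \<rat>" "t < r" "r < - q"
        using Rats_dense_in_real[of t "- q"] by auto
      then have "\<not> lower u p c r" using cSup_upper[OF _ bdd, of r] by (auto simp: t_def)
      with decide r have "lower u p (\<ominus> c) (- r)" by blast
      with r show "ev_forces p (\<ominus> c \<oplus> (- q) \<odot> u)" by (simp add: lower_def)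
    qed
    ultimately show "\<exists>t. has_val u p c t" by (auto simp: has_val_def)
  qed
qed

text \<open>If \<open>p\<close> forces every term below the threshold, \<open>forces_ssup\<close>
  with \<open>e = q \<odot> u\<close> puts the supremum below it; otherwise some term exceeds it on
  a part of \<open>p\<close>.\<close>

lemma dense_decide_ssup:
  assumes g: "g \<in> \<G>" and f: "\<And>n. f n \<in> \<G>"
  shows "dense_family (\<lambda>u. {p. forces p (\<ominus> ssup G g f \<oplus> q \<odot> u) \<or> (\<exists>n. forces p (f n \<sqinter> g \<oplus> (- q) \<odot> u))})"
  unfolding dense_family_def
proof (intro allI impI)
  fix u p assume u: "u \<in> \<G>" and p: "pos p"
  let ?S = "{p. forces p (\<ominus> ssup G g f \<oplus> q \<odot> u) \<or> (\<exists>n. forces p (f n \<sqinter> g \<oplus> (- q) \<odot> u))}"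
  let ?x = "\<lambda>n. f n \<sqinter> g \<oplus> (- q) \<odot> u"
  have x: "?x n \<in> \<G>" "\<ominus> ?x n = q \<odot> u \<oplus> \<ominus> (f n \<sqinter> g)" for n
    using u g f by (simp_all add: neg_add smult_neg group_ax(2))
  show "\<exists>p'. pos p' \<and> p' \<sqsubseteq> p \<and> p' \<in> ?S"
  proof (cases "\<forall>n. forces p (\<ominus> ?x n)")
    case True
    then have "forces p (q \<odot> u \<oplus> \<ominus> ssup G g f)"
      using u p g f by (intro forces_ssup) (auto simp: x(2))
    then have "p \<in> ?S" using u g f by (simp add: group_ax(2))
    then show ?thesis using p by (meson le_refl posD(1))
  next
    case False
    then obtain n where n: "\<not> forces p (\<ominus> ?x n)" by blast
    show ?thesis
      using forces_decide[OF p x(1) n] meet_le(1)[OF posD(1)[OF p] npart(1)[OF closed(5)[OF x(1)]], of n] by blast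
  qed
qed

text \<open>Monotonicity puts the value \<open>t\<close> of \<open>s\<close> above the values of the
  terms. A rational \<open>q\<close> strictly between their supremum and \<open>t\<close> is
  excluded: a generic chain either bounds \<open>s\<close> by \<open>q\<close>, against
  \<open>q < t\<close>, or lifts some term to \<open>q\<close>, against the choice of
  \<open>q\<close>.\<close>

lemma generically_ssup:
  assumes g: "g \<in> \<G>" and f: "\<And>n. f n \<in> \<G>"
  shows "generically (\<lambda>u p. \<forall>a b. (\<forall>n. has_val u p (f n) (a n)) \<longrightarrow> has_val u p g b \<longrightarrow>
    has_val u p (ssup G g f) (SUP n. min (a n) b))"
proof -
  define s where "s = ssup G g f"
  have s: "s \<in> \<G>" using g f by (simp add: s_def)
  have "generically (\<lambda>u p. (\<exists>t. has_val u p s t) \<and> (\<forall>q\<in>\<rat>.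
    \<exists>n. p n \<in> {p. forces p (\<ominus> s \<oplus> q \<odot> u) \<or> (\<exists>n. forces p (f n \<sqinter> g \<oplus> (- q) \<odot> u))}))"
    unfolding s_def using g f
    by (intro generically_conj generically_all generically_dense dense_decide_ssup countable_rat generically_has_val closed)
  then show ?thesis
    unfolding s_def[symmetric]
  proof (rule generically_mono, intro allI impI)
    fix u p a b
    assume ch: "chain u p" and a: "\<forall>n. has_val u p (f n) (a n)" and b: "has_val u p g b"
      and *: "(\<exists>t. has_val u p s t) \<and> (\<forall>q\<in>\<rat>.
        \<exists>n. p n \<in> {p. forces p (\<ominus> s \<oplus> q \<odot> u) \<or> (\<exists>n. forces p (f n \<sqinter> g \<oplus> (- q) \<odot> u))})"
    obtain t where t: "has_val u p s t" using * by blast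
    have h: "has_val u p (f n \<sqinter> g) (min (a n) b)" for n
      using ch a b f g by (intro has_val_meet) auto
    have le: "min (a n) b \<le> t" for n
      using has_val_mono[OF ch h t] ssup_ge[of g f] f g s by (simp add: s_def)
    have bdd: "bdd_above (range (\<lambda>n. min (a n) b))" using le by (auto simp: bdd_above_def)
    have "t \<le> (SUP n. min (a n) b)"
    proof (rule ccontr)
      assume "\<not> t \<le> (SUP n. min (a n) b)"
      then obtain q where q: "q \<in> \<rat>" "(SUP n. min (a n) b) < q" "q < t"
        using Rats_dense_in_real[of "SUP n. min (a n) b" t] by auto
      from * q(1) have "\<exists>n. forces (p n) (\<ominus> s \<oplus> q \<odot> u) \<or> (\<exists>m. forces (p n) (f m \<sqinter> g \<oplus> (- q) \<odot> u))"
        by blast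
      then consider "ev_forces p (\<ominus> s \<oplus> (- (- q)) \<odot> u)" | n where "ev_forces p (f n \<sqinter> g \<oplus> (- q) \<odot> u)"
        unfolding ev_forces_def minus_minus by blast
      then show False
      proof cases
        case 1
        from lowerI[OF ch _ this] have "lower u p (\<ominus> s) (- q)" using s by simp
        then show False using lower_le[OF ch, of s t q] t s q by (simp add: has_val_def)
      next
        case 2
        from lowerI[OF ch _ this] have "q \<le> min (a n) b"
          using lower_le[OF ch, of "f n \<sqinter> g" q "min (a n) b"] h[of n] f g by (simp add: has_val_def)
        also have "\<dots> \<le> (SUP n. min (a n) b)" by (rule cSUP_upper[OF UNIV_I bdd])
        finally show False using q by simp
      qed
    qed
    moreover have "(SUP n. min (a n) b) \<le> t" using le by (intro cSUP_least) auto
    ultimately show "has_val u p s (SUP n. min (a n) b)" using t by simp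
  qed
qed

section \<open>Valuations of generic chains\<close>

definition val :: "'a \<Rightarrow> (nat \<Rightarrow> 'a) \<Rightarrow> 'a \<Rightarrow> real" where
  "val u p c = (THE t. has_val u p c t)"

lemma val_eq: "chain u p \<Longrightarrow> has_val u p c t \<Longrightarrow> c \<in> \<G> \<Longrightarrow> val u p c = t"
  unfolding val_def by (blast intro: the_equality has_val_unique)

text \<open>Passes from the existence of a value to \<open>val\<close>, which is an unspecified real
  on chains that give \<open>c\<close> no value.\<close>

lemma generically_val:
  assumes "c \<in> \<G>"
  shows "generically (\<lambda>u p. has_val u p c (val u p c))"
  by (rule generically_mono[OF generically_has_val[OF assms]]) (use assms val_eq in auto)

text \<open>Each law is generic for fixed arguments only: a chain can be asked to meet only
  countably many families, while the carrier may be uncountable.\<close>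

lemma generically_val_ops:
  assumes "c \<in> \<G>" "d \<in> \<G>"
  shows "generically (\<lambda>u p. val u p \<zero> = 0)"
    "generically (\<lambda>u p. val u p (c \<oplus> d) = val u p c + val u p d)"
    "generically (\<lambda>u p. val u p (c \<squnion> d) = max (val u p c) (val u p d))"
    "generically (\<lambda>u p. val u p (c \<sqinter> d) = min (val u p c) (val u p d))"
    "generically (\<lambda>u p. val u p (\<ominus> c) = - val u p c)"
    "generically (\<lambda>u p. val u p (r \<odot> c) = r * val u p c)"
proof -
  have both: "generically (\<lambda>u p. has_val u p c (val u p c) \<and> has_val u p d (val u p d))"
    using assms by (intro generically_conj generically_val)
  show "generically (\<lambda>u p. val u p \<zero> = 0)"
    by (rule generically_always) (auto intro: val_eq has_val_zero)
  show "generically (\<lambda>u p. val u p (c \<oplus> d) = val u p c + val u p d)"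
    by (rule generically_mono[OF both]) (use assms in \<open>auto intro: val_eq has_val_add\<close>)
  show "generically (\<lambda>u p. val u p (c \<squnion> d) = max (val u p c) (val u p d))"
    by (rule generically_mono[OF both]) (use assms in \<open>auto intro: val_eq has_val_join\<close>)
  show "generically (\<lambda>u p. val u p (c \<sqinter> d) = min (val u p c) (val u p d))"
    by (rule generically_mono[OF both]) (use assms in \<open>auto intro: val_eq has_val_meet\<close>)
  show "generically (\<lambda>u p. val u p (\<ominus> c) = - val u p c)"
    by (rule generically_mono[OF both]) (use assms in \<open>auto intro: val_eq has_val_neg\<close>)
  show "generically (\<lambda>u p. val u p (r \<odot> c) = r * val u p c)"
    by (rule generically_mono[OF both]) (use assms in \<open>auto intro: val_eq has_val_smult\<close>)
qed

lemma generically_val_ssup: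
  assumes "g \<in> \<G>" "\<And>n. f n \<in> \<G>"
  shows "generically (\<lambda>u p. val u p (ssup G g f) = (SUP n. min (val u p (f n)) (val u p g)))"
proof -
  have "generically (\<lambda>u p. (\<forall>n\<in>UNIV. has_val u p (f n) (val u p (f n))) \<and> has_val u p g (val u p g) \<and>
     (\<forall>a b. (\<forall>n. has_val u p (f n) (a n)) \<longrightarrow> has_val u p g b \<longrightarrow>
      has_val u p (ssup G g f) (SUP n. min (a n) b)))"
    using assms by (intro generically_conj generically_all generically_val generically_ssup) auto
  then show ?thesis
    by (rule generically_mono) (use assms in \<open>auto intro!: val_eq\<close>)
qed

text \<open>With \<open>u\<close> the absolute value of the difference \<open>d\<close>, a generic
  chain below \<open>u\<close> would give \<open>a\<close> and \<open>b\<close> a common value, so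
  \<open>d\<close> and hence \<open>u\<close> would have value 0; but the unit has value 1.\<close>

lemma generically_val_eqD:
  assumes "generically (\<lambda>u p. val u p a = val u p b)" "a \<in> \<G>" "b \<in> \<G>"
  shows "a = b"
proof (rule ccontr)
  assume "a \<noteq> b"
  define d where "d = a \<oplus> \<ominus> b"
  define u where "u = d \<squnion> \<ominus> d"
  have d: "d \<in> \<G>" "\<ominus> d \<in> \<G>" and u: "u \<in> \<G>" using assms by (auto simp: d_def u_def)
  have du: "d \<sqsubseteq> u" "\<ominus> d \<sqsubseteq> u" using d by (auto simp: u_def)
  have "d \<noteq> \<zero>"
    using \<open>a \<noteq> b\<close> assms add_right_inject[of a b "\<ominus> b"] by (auto simp: d_def)
  \<comment> \<open>Adding the bounds on \<open>d\<close> and \<open>\<ominus> d\<close> shows that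
    twice \<open>u\<close> is nonnegative; halving gives \<open>u\<close> itself.\<close>
  have "\<zero> \<sqsubseteq> 2 \<odot> u"
    using add_mono[OF du] d u smult_ax(2)[of u 1 1] by simp
  then have "(1/2) \<odot> \<zero> \<sqsubseteq> (1/2) \<odot> 2 \<odot> u"
    using u by (intro smult_mono) auto
  then have "\<zero> \<sqsubseteq> u" using u by (simp add: smult_ax)
  moreover have "u \<noteq> \<zero>"
  proof
    assume "u = \<zero>"
    with du neg_mono[of "\<ominus> d" u] d have "d \<sqsubseteq> \<zero>" "\<zero> \<sqsubseteq> d" by auto
    with \<open>d \<noteq> \<zero>\<close> d show False using le_antisym by blast
  qed
  ultimately have "pos u" using u by (simp add: pos_def)
  have "generically (\<lambda>u p. val u p a = val u p b \<and> has_val u p a (val u p a) \<and> has_val u p b (val u p b))"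
    using assms by (intro generically_conj generically_val)
  from generically_ex[OF this \<open>pos u\<close>] obtain p t where p: "chain u p" "has_val u p a t" "has_val u p b t"
    by metis
  have "has_val u p d (t + - t)"
    unfolding d_def using p assms by (intro has_val_add has_val_neg) auto
  \<comment> \<open>The value is written in the form in which \<open>has_val_join\<close> delivers
    it for \<open>d \<squnion> \<ominus> d\<close>.\<close>
  then have "has_val u p u (max 0 (- 0))"
    unfolding u_def using p d by (intro has_val_join has_val_neg) (auto simp: u_def)
  then show False using has_val_unique[OF p(1) has_val_unit[OF p(1)]] u by fastforce
qed

section \<open>Agreement at generic valuations as a congruence\<close>

text \<open>A valuation \<open>v\<close> is encoded as the index \<open>{{v}}\<close> to match the required index type;
  the other indices are irrelevant.\<close>

definition gen_eq :: "((('a \<Rightarrow> real) set set) \<Rightarrow> real) rel" where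
  "gen_eq = {(x, y). generically (\<lambda>u p. x {{val u p}} = y {{val u p}})}"

definition evaluation :: "'a \<Rightarrow> ('a \<Rightarrow> real) set set \<Rightarrow> real" where
  "evaluation a = (\<lambda>i. the_elem (the_elem i) a)"

lemma evaluation_val [simp]: "evaluation a {{v}} = v a"
  by (simp add: evaluation_def)

text \<open>The operations of the power are pointwise, so each preserves agreement at an index; for
  \<open>ssup\<close> the countably many hypotheses combine into one generic statement.\<close>

lemma congruence_gen_eq: "congruence (real_power UNIV) gen_eq"
proof -
  have "equiv UNIV gen_eq"
  proof (rule equivI)
    show "refl gen_eq"
      by (auto simp: refl_on_def gen_eq_def intro: generically_always)
    show "sym gen_eq"
      unfolding gen_eq_def by (rule symI) (simp add: eq_commute)
    show "trans gen_eq"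
    proof (rule transI)
      fix x y z assume "(x, y) \<in> gen_eq" "(y, z) \<in> gen_eq"
      then have "generically (\<lambda>u p. x {{val u p}} = y {{val u p}} \<and> y {{val u p}} = z {{val u p}})"
        by (simp add: gen_eq_def generically_conj)
      then show "(x, z) \<in> gen_eq"
        unfolding gen_eq_def mem_Collect_eq case_prod_conv by (rule generically_mono) simp
    qed
  qed auto
  \<comment> \<open>An arbitrary \<open>F\<close> serves sum, join and meet at once; the unary
    version below does the same for negation and scalar multiplication.\<close>
  moreover have "((\<lambda>i. F (x i) (y i)), (\<lambda>i. F (x' i) (y' i))) \<in> gen_eq"
    if "(x, x') \<in> gen_eq" "(y, y') \<in> gen_eq" for x x' y y' and F :: "real \<Rightarrow> real \<Rightarrow> real"
  proof -
    have "generically (\<lambda>u p. x {{val u p}} = x' {{val u p}} \<and> y {{val u p}} = y' {{val u p}})"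
      using that by (simp add: gen_eq_def generically_conj)
    then show ?thesis
      unfolding gen_eq_def mem_Collect_eq case_prod_conv by (rule generically_mono) simp
  qed
  moreover have "((\<lambda>i. F (x i)), (\<lambda>i. F (x' i))) \<in> gen_eq"
    if "(x, x') \<in> gen_eq" for x x' and F :: "real \<Rightarrow> real"
    using that unfolding gen_eq_def mem_Collect_eq case_prod_conv by (rule generically_mono) simp
  moreover have "((\<lambda>i. SUP n. min (f n i) (g i)), (\<lambda>i. SUP n. min (f' n i) (g' i))) \<in> gen_eq"
    if "(g, g') \<in> gen_eq" "\<And>n. (f n, f' n) \<in> gen_eq"
    for g g' and f f' :: "nat \<Rightarrow> ('a \<Rightarrow> real) set set \<Rightarrow> real"
  proof -
    have "generically (\<lambda>u p. g {{val u p}} = g' {{val u p}} \<and>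
        (\<forall>n\<in>UNIV. f n {{val u p}} = f' n {{val u p}}))"
      using that by (intro generically_conj generically_all) (auto simp: gen_eq_def)
    then show ?thesis
      unfolding gen_eq_def mem_Collect_eq case_prod_conv by (rule generically_mono) simp
  qed
  ultimately show ?thesis
    by (simp add: congruence_def real_power_def)
qed

end

section \<open>Embedding into a quotient\<close>

text \<open>\<open>e\<close> respects the operations only modulo \<open>\<theta>\<close>. The
  quotient operates on chosen representatives; these are related to the images under
  \<open>e\<close>, so compatibility of \<open>\<theta>\<close> absorbs the choice.\<close>

lemma hom_quot:
  fixes G :: "'a srs" and A :: "'b srs"
  assumes "congruence A \<theta>"
    and e: "\<And>x. x \<in> carrier G \<Longrightarrow> e x \<in> carrier A"
    and zero: "(e (zero G), zero A) \<in> \<theta>"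
    and add: "\<And>x y. x \<in> carrier G \<Longrightarrow> y \<in> carrier G \<Longrightarrow> (e (add G x y), add A (e x) (e y)) \<in> \<theta>"
    and join: "\<And>x y. x \<in> carrier G \<Longrightarrow> y \<in> carrier G \<Longrightarrow> (e (join G x y), join A (e x) (e y)) \<in> \<theta>"
    and meet: "\<And>x y. x \<in> carrier G \<Longrightarrow> y \<in> carrier G \<Longrightarrow> (e (meet G x y), meet A (e x) (e y)) \<in> \<theta>"
    and neg: "\<And>x. x \<in> carrier G \<Longrightarrow> (e (neg G x), neg A (e x)) \<in> \<theta>"
    and smult: "\<And>x r. x \<in> carrier G \<Longrightarrow> (e (smult G r x), smult A r (e x)) \<in> \<theta>"
    and ssup: "\<And>g (f :: nat \<Rightarrow> 'a). g \<in> carrier G \<Longrightarrow> (\<And>n. f n \<in> carrier G) \<Longrightarrow>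
      (e (ssup G g f), ssup A (e g) (\<lambda>n. e (f n))) \<in> \<theta>"
  shows "hom (\<lambda>x. \<theta> `` {e x}) G (quot A \<theta>)"
proof -
  have eqv: "equiv (carrier A) \<theta>" using assms(1) by (simp add: congruence_def)
  have rep: "(e x, rep (\<theta> `` {e x})) \<in> \<theta>" if "x \<in> carrier G" for x
  proof -
    have "e x \<in> \<theta> `` {e x}" using equiv_class_self[OF eqv] e that by blast
    then have "rep (\<theta> `` {e x}) \<in> \<theta> `` {e x}" unfolding rep_def by (rule someI)
    then show ?thesis by simp
  qed
  have eq: "\<theta> `` {x} = \<theta> `` {z}" if "(x, y) \<in> \<theta>" "(y, z) \<in> \<theta>" for x y z
    using equiv_class_eq[OF eqv] that by blast
  note c = assms(1)[unfolded congruence_def]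
  show ?thesis
    unfolding hom_def
  proof (intro conjI ballI allI impI)
    show "\<theta> `` {e x} \<in> carrier (quot A \<theta>)" if "x \<in> carrier G" for x
      using e[OF that] by (simp add: quot_def quotientI)
    show "\<theta> `` {e (zero G)} = zero (quot A \<theta>)"
      using equiv_class_eq[OF eqv zero] by (simp add: quot_def)
    fix x y assume x: "x \<in> carrier G" and y: "y \<in> carrier G"
    show "\<theta> `` {e (add G x y)} = add (quot A \<theta>) (\<theta> `` {e x}) (\<theta> `` {e y})"
      using eq[OF add[OF x y]] c rep x y by (simp add: quot_def)
    show "\<theta> `` {e (join G x y)} = join (quot A \<theta>) (\<theta> `` {e x}) (\<theta> `` {e y})"
      using eq[OF join[OF x y]] c rep x y by (simp add: quot_def)
    show "\<theta> `` {e (meet G x y)} = meet (quot A \<theta>) (\<theta> `` {e x}) (\<theta> `` {e y})"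
      using eq[OF meet[OF x y]] c rep x y by (simp add: quot_def)
  next
    fix x r assume x: "x \<in> carrier G"
    show "\<theta> `` {e (neg G x)} = neg (quot A \<theta>) (\<theta> `` {e x})"
      using eq[OF neg[OF x]] c rep x by (simp add: quot_def)
    show "\<theta> `` {e (smult G r x)} = smult (quot A \<theta>) r (\<theta> `` {e x})"
      using eq[OF smult[OF x]] c rep x by (simp add: quot_def)
  next
    fix g and f :: "nat \<Rightarrow> 'a"
    assume g: "g \<in> carrier G" and f: "\<forall>n. f n \<in> carrier G"
    show "\<theta> `` {e (ssup G g f)} = ssup (quot A \<theta>) (\<theta> `` {e g}) (\<lambda>n. \<theta> `` {e (f n)})"
      using eq[OF ssup[OF g]] c rep g f by (simp add: quot_def)
  qed
qed

lemma subalgebra_hom_image: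
  assumes h: "hom h G B" and G: "closed_ops G"
  shows "subalgebra (h ` carrier G) B"
proof -
  note h = h[unfolded hom_def] and G = G[unfolded closed_ops_def]
  have "ssup B g f \<in> h ` carrier G" if g: "g \<in> h ` carrier G" and f: "\<And>n. f n \<in> h ` carrier G" for g f
  proof -
    obtain g' where g': "g' \<in> carrier G" "g = h g'" using g by blast
    \<comment> \<open>Preimages of the whole sequence are chosen at once, giving a sequence in
      \<open>G\<close> to which \<open>ssup\<close> applies.\<close>
    have "\<forall>n. \<exists>x. x \<in> carrier G \<and> f n = h x" using f by blast
    then obtain f' where f': "\<And>n. f' n \<in> carrier G" "\<And>n. f n = h (f' n)" by metis
    have "f = (\<lambda>n. h (f' n))" using f' by auto
    then have "ssup B g f = h (ssup G g' f')" using h g' f' by simp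
    then show ?thesis using G g' f' by simp
  qed
  moreover have "zero B \<in> h ` carrier G" using h G by (metis imageI)
  moreover have "add B (h x) (h y) \<in> h ` carrier G" "join B (h x) (h y) \<in> h ` carrier G"
    "meet B (h x) (h y) \<in> h ` carrier G" "neg B (h x) \<in> h ` carrier G" "smult B r (h x) \<in> h ` carrier G"
    if "x \<in> carrier G" "y \<in> carrier G" for x y r
    using that h G by (metis imageI)+
  ultimately show ?thesis
    using h by (simp add: subalgebra_def closed_ops_def image_subset_iff)
qed

theorem mainTheorem14:
  fixes G :: "'a srs"
  assumes "sigma_rs G"
  shows "\<exists>(I :: ('a \<Rightarrow> real) set set set) \<theta> S h.
           congruence (real_power I) \<theta> \<and>
           iso_to_subalgebra h G S (quot (real_power I) \<theta>)"
proof -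
  interpret sigma_riesz G using assms by unfold_locales
  \<comment> \<open>With all indices allowed, the support condition in \<open>real_power\<close> is
    vacuous and every function lies in the carrier.\<close>
  let ?A = "real_power UNIV" and ?h = "\<lambda>a. gen_eq `` {evaluation a}"
  \<comment> \<open>Each compatibility condition unfolds to a generic law of \<open>val\<close>,
    since \<open>evaluation a\<close> takes the value \<open>val u p a\<close> at the index encoding
    \<open>val u p\<close>.\<close>
  have hom: "hom ?h G (quot ?A gen_eq)"
    by (rule hom_quot[OF congruence_gen_eq])
      (simp_all add: real_power_def gen_eq_def generically_val_ops generically_val_ops(1)[OF closed(1,1)] generically_val_ssup)
  have "inj_on ?h (carrier G)"
  proof (rule inj_onI)
    fix a b assume ab: "a \<in> carrier G" "b \<in> carrier G" and "?h a = ?h b"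
    then have "(evaluation a, evaluation b) \<in> gen_eq"
      using congruence_gen_eq eq_equiv_class[of gen_eq "evaluation a" "evaluation b" UNIV]
      by (simp add: congruence_def real_power_def)
    then show "a = b" using ab generically_val_eqD by (simp add: gen_eq_def)
  qed
  then have "iso_to_subalgebra ?h G (?h ` carrier G) (quot ?A gen_eq)"
    using hom subalgebra_hom_image[OF hom] assms
    by (simp add: iso_to_subalgebra_def bij_betw_def sigma_rs_def)
  then show ?thesis using congruence_gen_eq by blast
qed

end
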